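(* Let $\Omega\subset\mathbb{R}^2$ be a bounded domain with Lipschitz boundary, let $k\in\mathbb{R}\setminus\{0\}$ and $L=\begin{pmatrix}0&k\\1&0\end{pmatrix}$, and let $\mathcal{L}(\xi)=\sum_{i,j}L_{ij}\xi_{ij}=k\xi_{12}+\xi_{21}$ for $\xi\in\mathbb{M}^{2\times 2}$. Let $K\subset\mathbb{M}^{2\times 2}$ be the set consisting of the four diagonal matrices $$A_1=-A_3=\begin{pmatrix}3&0\\0&-1\end{pmatrix},\qquad A_2=-A_4=\begin{pmatrix}1&0\\0&3\end{pmatrix},$$ and let $\eta\in K^{rc}$, $\gamma\in\mathbb{R}^2$ and $\epsilon>0$. Then there exists a map $u\in W^{1,\infty}(\Omega;\mathbb{R}^2)$ such that $$\begin{cases}\operatorname{dist}(\nabla u,K)<\epsilon & \text{a.e. in }\Omega,\\ \mathcal{L}(\nabla u)=0 & \text{a.e. in }\Omega,\\ u=v_{\eta,\gamma} & \text{on }\partial\Omega,\\ \|u-v_{\eta,\gamma}\|_{L^\infty(\Omega)}<\epsilon, & \end{cases}$$ where $v_{\eta,\gamma}(x):=\eta x+\gamma$ for $x\in\Omega$.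
   Context: $\mathbb{M}^{2\times 2}$ is the space of real $2\times 2$ matrices with the Hilbert–Schmidt norm $|\xi|=(\sum_{i,j}\xi_{ij}^2)^{1/2}$, with respect to which $\operatorname{dist}$ is taken. $\nabla u$ is the matrix with entries $\partial u^i/\partial x_j$. "$u=v$ on $\partial\Omega$" means $u\in v+W^{1,\infty}_0(\Omega;\mathbb{R}^2)$. A function $f:\mathbb{M}^{2\times 2}\to\mathbb{R}$ is rank-one convex if $f(\lambda\xi_1+(1-\lambda)\xi_2)\le\lambda f(\xi_1)+(1-\lambda)f(\xi_2)$ for all $\xi_1,\xi_2$ with $\operatorname{rank}(\xi_1-\xi_2)=1$ and all $\lambda\in[0,1]$. For compact $K$, $K^{rc}=\{\xi\in\mathbb{M}^{2\times 2} : f(\xi)\le\sup_K f\ \text{for all rank-one convex } f:\mathbb{M}^{2\times 2}\to\mathbb{R}\}$. *)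

theory Defs
  imports "HOL-Probability.Essential_Supremum"
begin

section \<open>Domains\<close>

text \<open>The matrix type \<open>real^'n^'m\<close> has \<open>m\<close> rows and \<open>n\<close> columns; its library norm is the
  L2 norm of the L2 norms of the rows, that is, the Hilbert--Schmidt norm.\<close>

text \<open>Near each boundary point, after a rigid motion, the set is the strict epigraph of a
  Lipschitz function.\<close>

definition lipschitz_boundary :: "(real^2) set \<Rightarrow> bool" where
  "lipschitz_boundary \<Omega> \<longleftrightarrow>
    (\<forall>p\<in>frontier \<Omega>. \<exists>r>0. \<exists>T :: real^2 \<Rightarrow> real^2. \<exists>g :: real \<Rightarrow> real. \<exists>M.
       orthogonal_transformation T \<and> M-lipschitz_on UNIV g \<and>
       \<Omega> \<inter> ball p r = {x \<in> ball p r. T (x - p) $ 2 > g (T (x - p) $ 1)})"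

definition bounded_lipschitz_domain :: "(real^2) set \<Rightarrow> bool" where
  "bounded_lipschitz_domain \<Omega> \<longleftrightarrow>
    open \<Omega> \<and> connected \<Omega> \<and> \<Omega> \<noteq> {} \<and> bounded \<Omega> \<and> lipschitz_boundary \<Omega>"

section \<open>Sobolev spaces\<close>

primrec C_k :: "nat \<Rightarrow> (real^'n \<Rightarrow> 'b::real_normed_vector) \<Rightarrow> bool" where
  "C_k 0 f \<longleftrightarrow> continuous_on UNIV f"
| "C_k (Suc m) f \<longleftrightarrow> (\<forall>x. f differentiable (at x)) \<and>
     (\<forall>j. C_k m (\<lambda>x. frechet_derivative f (at x) (axis j 1)))"

definition test_function :: "(real^'n) set \<Rightarrow> (real^'n \<Rightarrow> 'b::real_normed_vector) \<Rightarrow> bool" where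
  "test_function \<Omega> \<phi> \<longleftrightarrow>
    (\<forall>m. C_k m \<phi>) \<and> (\<exists>C. compact C \<and> C \<subseteq> \<Omega> \<and> (\<forall>x. x \<notin> C \<longrightarrow> \<phi> x = 0))"

definition locally_integrable ::
    "(real^'n) set \<Rightarrow> (real^'n \<Rightarrow> 'b::euclidean_space) \<Rightarrow> bool" where
  "locally_integrable \<Omega> f \<longleftrightarrow> (\<forall>C. compact C \<and> C \<subseteq> \<Omega> \<longrightarrow> set_integrable lebesgue C f)"

text \<open>Functions on \<open>\<Omega>\<close> are represented by total functions, considered up to null sets; their
  values outside \<open>\<Omega>\<close> are irrelevant. The entry \<open>G x $ i $ j\<close> is the weak partial
  derivative of the component \<open>u $ i\<close> in direction \<open>j\<close>.\<close>

definition has_weak_gradient ::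
    "(real^'n) set \<Rightarrow> (real^'n \<Rightarrow> real^'m) \<Rightarrow> (real^'n \<Rightarrow> real^'n^'m) \<Rightarrow> bool" where
  "has_weak_gradient \<Omega> u G \<longleftrightarrow>
    locally_integrable \<Omega> u \<and> locally_integrable \<Omega> G \<and>
    (\<forall>\<phi> :: real^'n \<Rightarrow> real. test_function \<Omega> \<phi> \<longrightarrow>
      (\<forall>i j. (LINT x:\<Omega>|lebesgue. u x $ i * frechet_derivative \<phi> (at x) (axis j 1)) =
             - (LINT x:\<Omega>|lebesgue. G x $ i $ j * \<phi> x)))"

definition Linf_norm :: "(real^'n) set \<Rightarrow> (real^'n \<Rightarrow> 'b::euclidean_space) \<Rightarrow> ereal" where
  "Linf_norm \<Omega> f = esssup (lebesgue_on \<Omega>) (\<lambda>x. ereal (norm (f x)))"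

definition Linf :: "(real^'n) set \<Rightarrow> (real^'n \<Rightarrow> 'b::euclidean_space) set" where
  "Linf \<Omega> = {f. f \<in> borel_measurable (lebesgue_on \<Omega>) \<and> Linf_norm \<Omega> f < \<infinity>}"

definition W1inf :: "(real^'n) set \<Rightarrow> (real^'n \<Rightarrow> real^'m) set" where
  "W1inf \<Omega> = {u \<in> Linf \<Omega>. \<exists>G \<in> Linf \<Omega>. has_weak_gradient \<Omega> u G}"

text \<open>The closure of the test functions in the norm of \<open>W\<^sup>1\<^sup>,\<^sup>1\<close>. The nonnegative integral
  is used because, unlike the Bochner integral, it is not zero on non-integrable functions.\<close>

definition W11_0 :: "(real^'n) set \<Rightarrow> (real^'n \<Rightarrow> real^'m) set" where
  "W11_0 \<Omega> = {w. \<exists>G \<phi>. has_weak_gradient \<Omega> w G \<and> (\<forall>n. test_function \<Omega> (\<phi> n)) \<and>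
     (\<lambda>n. \<integral>\<^sup>+x\<in>\<Omega>. ennreal (norm (w x - \<phi> n x)) \<partial>lebesgue) \<longlonglongrightarrow> 0 \<and>
     (\<lambda>n. \<integral>\<^sup>+x\<in>\<Omega>. ennreal (norm (G x - jacobian (\<phi> n) (at x))) \<partial>lebesgue)
       \<longlonglongrightarrow> 0}"

text \<open>The usual convention \<open>W\<^sup>1\<^sup>,\<^sup>\<infinity>\<^sub>0 = W\<^sup>1\<^sup>,\<^sup>\<infinity> \<inter> W\<^sup>1\<^sup>,\<^sup>1\<^sub>0\<close>. The closure of the test functions in the
  norm of \<open>W\<^sup>1\<^sup>,\<^sup>\<infinity>\<close> would contain only continuously differentiable functions.\<close>

definition W1inf_0 :: "(real^'n) set \<Rightarrow> (real^'n \<Rightarrow> real^'m) set" where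
  "W1inf_0 \<Omega> = W1inf \<Omega> \<inter> W11_0 \<Omega>"

section \<open>Rank-one convexity\<close>

definition rank_one_convex :: "(real^2^2 \<Rightarrow> real) \<Rightarrow> bool" where
  "rank_one_convex f \<longleftrightarrow>
    (\<forall>\<xi>1 \<xi>2. rank (\<xi>1 - \<xi>2) = 1 \<longrightarrow>
      (\<forall>t\<in>{0..1}. f (t *\<^sub>R \<xi>1 + (1 - t) *\<^sub>R \<xi>2) \<le> t * f \<xi>1 + (1 - t) * f \<xi>2))"

text \<open>Intended for nonempty compact \<open>K\<close>: rank-one convex functions are continuous, so the
  supremum is then a genuine one.\<close>

definition rc_hull :: "(real^2^2) set \<Rightarrow> (real^2^2) set" where
  "rc_hull K = {\<xi>. \<forall>f. rank_one_convex f \<longrightarrow> f \<xi> \<le> (SUP \<zeta>\<in>K. f \<zeta>)}"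

section \<open>The data of the problem\<close>

definition L_mat :: "real \<Rightarrow> real^2^2" where
  "L_mat k = vector [vector [0, k], vector [1, 0]]"

definition L_form :: "real \<Rightarrow> real^2^2 \<Rightarrow> real" where
  "L_form k \<xi> = (\<Sum>i\<in>UNIV. \<Sum>j\<in>UNIV. L_mat k $ i $ j * \<xi> $ i $ j)"

definition A1 :: "real^2^2" where "A1 = vector [vector [3, 0], vector [0, -1]]"
definition A2 :: "real^2^2" where "A2 = vector [vector [1, 0], vector [0, 3]]"
definition A3 :: "real^2^2" where "A3 = - A1"
definition A4 :: "real^2^2" where "A4 = - A2"

definition K_set :: "(real^2^2) set" where
  "K_set = {A1, A2, A3, A4}"

definition affine_map :: "real^2^2 \<Rightarrow> real^2 \<Rightarrow> real^2 \<Rightarrow> real^2" where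
  "affine_map \<eta> \<gamma> x = \<eta> *v x + \<gamma>"

end

theory Submission
  imports Defs
begin

text \<open>Every smooth \<open>\<psi>\<close> gives a field \<open>w = (\<partial>\<^sub>1\<psi>, -k \<partial>\<^sub>2\<psi>)\<close> with \<open>k \<partial>\<^sub>2w\<^sub>1 + \<partial>\<^sub>1w\<^sub>2 = 0\<close>, so \<open>u\<close> is sought
  as the affine map plus a limit of such fields. The gradients of all approximations stay in a
  small open neighbourhood of the rank-one convex hull, which consists of a square with four arms.
  Each point of this neighbourhood that is not close to \<open>K\<close> is the midpoint of an axis-parallel segment
  in it, and the axis directions \<open>e\<^sub>j \<otimes> e\<^sub>j\<close> are gradients of fields of the above form. Hence
  on the open set where the gradient is not yet close to \<open>K\<close> one can add a rapid oscillation of small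
  sup norm which increases the squared \<open>L\<^sup>2\<close> norm of the gradient by a fixed multiple of the measure of that
  set. The squared norm is bounded, so these measures tend to \<open>0\<close>; as nothing changes outside
  the sets, the gradients become stationary almost everywhere.\<close>

section \<open>Smooth functions\<close>

text \<open>No two matrices of \<open>K_set\<close> differ by a matrix of rank one (this is Tartar's
  square), so no oscillation between two of them is available, and no finite chain of splittings of
  another matrix ends in \<open>K_set\<close>. Progress is therefore measured by an energy instead
  of an explicit laminate. The hull moreover consists of diagonal matrices and has empty interior,
  whereas cutting off an oscillation leaves small off-diagonal entries; hence the open
  neighbourhood. The constraint survives cutoffs because they act on the potential, not on the
  field. The tolerance makes the gain uniform: for a fixed s every bad point has a segment of the
  same length s, so the gain factor is the same at every stage. The oscillations have amplitude of
  order \<open>\<tau>\<^sup>2\<close> at wavelength \<open>\<tau>\<close>, so the second derivatives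
  of the potential are of order one and the first derivatives of order \<open>\<tau>\<close>.
  Integration by parts then makes the mixed term with the previous gradient negligible, and the
  oscillation adds its own energy.\<close>

definition pd :: "'n \<Rightarrow> (real^'n \<Rightarrow> 'b::real_normed_vector) \<Rightarrow> real^'n \<Rightarrow> 'b" where
  "pd j f = (\<lambda>x. frechet_derivative f (at x) (axis j 1))"

definition smooth :: "(real^'n \<Rightarrow> 'b::real_normed_vector) \<Rightarrow> bool" where
  "smooth f \<longleftrightarrow> (\<forall>m. C_k m f)"

lemma C_k_Suc: "C_k (Suc m) f \<longleftrightarrow> (\<forall>x. f differentiable (at x)) \<and> (\<forall>j. C_k m (pd j f))"
  by (simp add: pd_def)

lemma pd_eqI: "(f has_derivative f') (at x) \<Longrightarrow> pd j f x = f' (axis j 1)"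
  unfolding pd_def by (metis frechet_derivative_at)

lemma C_k_SucD: "C_k (Suc m) f \<Longrightarrow> C_k m f"
proof (induction m arbitrary: f)
  case 0
  then show ?case
    by (auto intro!: continuous_at_imp_continuous_on differentiable_imp_continuous_within)
next
  case (Suc m)
  then show ?case by (meson C_k_Suc)
qed

lemma C_k_const: "C_k m (\<lambda>x::real^'n. c)"
proof (induction m arbitrary: c)
  case (Suc m)
  have "pd j (\<lambda>x::real^'n. c) = (\<lambda>x. 0)" for j
    by (intro ext) (rule pd_eqI[OF has_derivative_const])
  with Suc show ?case by (simp add: C_k_Suc del: C_k.simps(2))
qed simp

lemma pd_add:
  assumes "f differentiable (at x)" "g differentiable (at x)"
  shows "pd j (\<lambda>x. f x + g x) x = pd j f x + pd j g x"
proof -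
  obtain f' g' where d: "(f has_derivative f') (at x)" "(g has_derivative g') (at x)"
    using assms by (auto simp: differentiable_def)
  show ?thesis
    using pd_eqI[OF has_derivative_add[OF d]] pd_eqI[OF d(1)] pd_eqI[OF d(2)] by simp
qed

lemma pd_mult:
  fixes f g :: "real^'n \<Rightarrow> real"
  assumes "f differentiable (at x)" "g differentiable (at x)"
  shows "pd j (\<lambda>x. f x * g x) x = f x * pd j g x + pd j f x * g x"
proof -
  obtain f' g' where d: "(f has_derivative f') (at x)" "(g has_derivative g') (at x)"
    using assms by (auto simp: differentiable_def)
  show ?thesis
    using pd_eqI[OF has_derivative_mult[OF d]] pd_eqI[OF d(1)] pd_eqI[OF d(2)] by simp
qed

lemma pd_linear:
  assumes "bounded_linear h" "f differentiable (at x)"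
  shows "pd j (\<lambda>x. h (f x)) x = h (pd j f x)"
proof -
  obtain f' where d: "(f has_derivative f') (at x)"
    using assms by (auto simp: differentiable_def)
  show ?thesis
    using pd_eqI[OF bounded_linear.has_derivative[OF assms(1) d]] pd_eqI[OF d] by simp
qed

lemma pd_chain:
  assumes "(h has_real_derivative h') (at (g x))" "g differentiable (at x)"
  shows "pd j (\<lambda>x. h (g x)) x = h' * pd j g x"
proof -
  obtain g' where d: "(g has_derivative g') (at x)"
    using assms by (auto simp: differentiable_def)
  have "((\<lambda>x. h (g x)) has_derivative (\<lambda>y. h' * g' y)) (at x)"
    using diff_chain_at[OF d assms(1)[unfolded has_field_derivative_def]]
    by (simp add: o_def)
  from pd_eqI[OF this] pd_eqI[OF d] show ?thesis by simp
qed

lemma C_k_add: "C_k m f \<Longrightarrow> C_k m g \<Longrightarrow> C_k m (\<lambda>x. f x + g x)"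
proof (induction m arbitrary: f g)
  case 0
  then show ?case by (auto intro: continuous_intros)
next
  case (Suc m)
  have "pd j (\<lambda>x. f x + g x) = (\<lambda>x. pd j f x + pd j g x)" for j
    using Suc.prems by (intro ext pd_add) (auto simp: C_k_Suc)
  with Suc show ?case by (auto simp: C_k_Suc simp del: C_k.simps(2) intro: derivative_intros)
qed

lemma C_k_mult:
  fixes f g :: "real^'n \<Rightarrow> real"
  shows "C_k m f \<Longrightarrow> C_k m g \<Longrightarrow> C_k m (\<lambda>x. f x * g x)"
proof (induction m arbitrary: f g)
  case 0
  then show ?case by (auto intro: continuous_intros)
next
  case (Suc m)
  have "pd j (\<lambda>x. f x * g x) = (\<lambda>x. f x * pd j g x + pd j f x * g x)" for j
    using Suc.prems by (intro ext pd_mult) (auto simp: C_k_Suc)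
  moreover have "C_k m f" "C_k m g" using Suc.prems by (blast dest: C_k_SucD)+
  ultimately show ?case
    using Suc by (auto simp: C_k_Suc simp del: C_k.simps(2) intro!: C_k_add derivative_intros)
qed

lemma C_k_linear:
  assumes "bounded_linear h"
  shows "C_k m f \<Longrightarrow> C_k m (\<lambda>x. h (f x))"
proof (induction m arbitrary: f)
  case 0
  then show ?case using bounded_linear.continuous_on[OF assms] by simp
next
  case (Suc m)
  have "pd j (\<lambda>x. h (f x)) = (\<lambda>x. h (pd j f x))" for j
    using Suc.prems by (intro ext pd_linear assms) (auto simp: C_k_Suc)
  moreover have "(\<lambda>x. h (f x)) differentiable at x" for x
    using Suc.prems bounded_linear.has_derivative[OF assms]
    unfolding C_k_Suc differentiable_def by blast
  ultimately show ?case
    using Suc by (auto simp: C_k_Suc simp del: C_k.simps(2))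
qed

text \<open>Induction on \<open>m\<close> would break for a single \<open>h\<close>, because its
  derivative is another function. It therefore runs over a family \<open>S\<close> in which every
  derivative is a combination of two members. Two terms suffice for both uses: the functions
  \<open>flat n\<close>, and sine with cosine.\<close>

lemma C_k_compose:
  fixes g :: "real^'n \<Rightarrow> real"
  assumes S: "\<And>h. h \<in> S \<Longrightarrow> \<exists>h1\<in>S. \<exists>h2\<in>S. \<exists>a b. \<forall>t.
                 (h has_real_derivative a * h1 t + b * h2 t) (at t)"
    and g: "smooth g"
  shows "h \<in> S \<Longrightarrow> C_k m (\<lambda>x. h (g x))"
proof (induction m arbitrary: h)
  case 0
  then obtain h1 h2 a b where "\<And>t. (h has_real_derivative a * h1 t + b * h2 t) (at t)"
    using S by blast
  then have "continuous_on UNIV h"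
    by (intro continuous_at_imp_continuous_on ballI DERIV_isCont)
  moreover have "continuous_on UNIV g" using g by (metis C_k.simps(1) smooth_def)
  ultimately show ?case
    using continuous_on_compose2[of UNIV h UNIV g] by simp
next
  case (Suc m)
  obtain h1 h2 a b where h: "h1 \<in> S" "h2 \<in> S"
      "\<And>t. (h has_real_derivative a * h1 t + b * h2 t) (at t)" using S[OF Suc.prems] by blast
  have dg: "g differentiable at x" for x using g by (metis C_k_Suc smooth_def)
  have "pd j (\<lambda>x. h (g x)) = (\<lambda>x. (a * h1 (g x) + b * h2 (g x)) * pd j g x)" for j
    by (intro ext pd_chain h dg)
  moreover have "C_k m (pd j g)" for j using g by (metis C_k_Suc smooth_def)
  moreover have "(\<lambda>x. h (g x)) differentiable at x" for x
  proof -
    obtain g' where "(g has_derivative g') (at x)" using dg by (auto simp: differentiable_def)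
    from diff_chain_at[OF this h(3)[unfolded has_field_derivative_def]] show ?thesis
      by (auto simp: differentiable_def o_def)
  qed
  ultimately show ?case using Suc.IH h(1,2)
    by (auto simp: C_k_Suc simp del: C_k.simps(2) intro!: C_k_mult C_k_add C_k_const)
qed

lemma smooth_pd: "smooth f \<Longrightarrow> smooth (pd j f)"
  unfolding smooth_def using C_k_Suc by blast

lemma smooth_differentiable: "smooth f \<Longrightarrow> f differentiable (at x)"
  unfolding smooth_def using C_k_Suc by blast

lemma smooth_continuous: "smooth f \<Longrightarrow> continuous_on S f"
  unfolding smooth_def by (metis C_k.simps(1) continuous_on_subset subset_UNIV)

lemma smooth_has_derivative: "smooth f \<Longrightarrow> (f has_derivative frechet_derivative f (at x)) (at x)"
  using smooth_differentiable frechet_derivative_works by blast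

lemma smooth_const: "smooth (\<lambda>x. c)"
  by (simp add: smooth_def C_k_const)

lemma smooth_add: "smooth f \<Longrightarrow> smooth g \<Longrightarrow> smooth (\<lambda>x. f x + g x)"
  by (simp add: smooth_def C_k_add)

lemma smooth_mult:
  fixes f g :: "real^'n \<Rightarrow> real"
  shows "smooth f \<Longrightarrow> smooth g \<Longrightarrow> smooth (\<lambda>x. f x * g x)"
  by (simp add: smooth_def C_k_mult)

lemma smooth_linear: "bounded_linear h \<Longrightarrow> smooth f \<Longrightarrow> smooth (\<lambda>x. h (f x))"
  by (simp add: smooth_def C_k_linear)

lemma smooth_uminus: "smooth f \<Longrightarrow> smooth (\<lambda>x. - f x)"
  by (rule smooth_linear[OF bounded_linear_minus[OF bounded_linear_ident]])

lemma smooth_diff: "smooth f \<Longrightarrow> smooth g \<Longrightarrow> smooth (\<lambda>x. f x - g x)"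
  using smooth_add[OF _ smooth_uminus] by fastforce

lemma smooth_sum: "(\<And>i. i \<in> I \<Longrightarrow> smooth (f i)) \<Longrightarrow> smooth (\<lambda>x. \<Sum>i\<in>I. f i x)"
  by (induction I rule: infinite_finite_induct) (auto intro: smooth_const smooth_add)

lemma smooth_compose:
  fixes g :: "real^'n \<Rightarrow> real"
  assumes "\<And>h. h \<in> S \<Longrightarrow> \<exists>h1\<in>S. \<exists>h2\<in>S. \<exists>a b. \<forall>t.
                 (h has_real_derivative a * h1 t + b * h2 t) (at t)"
    and "smooth g" "h \<in> S"
  shows "smooth (\<lambda>x. h (g x))"
  unfolding smooth_def using C_k_compose[of S, OF assms] by blast

lemma smooth_id: "smooth (\<lambda>x. x)"
proof -
  have "C_k (Suc m) (\<lambda>x::real^'n. x)" for m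
  proof -
    have "pd j (\<lambda>x::real^'n. x) = (\<lambda>x. axis j 1)" for j
      by (intro ext) (rule pd_eqI[OF has_derivative_ident])
    then show ?thesis by (simp add: C_k_Suc C_k_const del: C_k.simps(2))
  qed
  then show ?thesis unfolding smooth_def using C_k_SucD by blast
qed

lemma smooth_nth: "smooth (\<lambda>x. x $ i)"
  by (rule smooth_linear[OF bounded_linear_vec_nth smooth_id])

lemma pd_nth: "pd j (\<lambda>x. x $ i) x = (if i = j then 1 else 0)"
  using pd_eqI[OF bounded_linear.has_derivative[OF bounded_linear_vec_nth has_derivative_ident], of j i x]
  by (simp add: axis_def)

lemma pd_zero_outside:
  assumes "closed K" "\<And>x. x \<notin> K \<Longrightarrow> f x = 0" "x \<notin> K"
  shows "pd j f x = 0"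
proof -
  have "(f has_derivative (\<lambda>h. 0)) (at x)"
    by (rule has_derivative_transform_within_open[of "\<lambda>x. 0", OF _ open_Compl[OF assms(1)]])
       (use assms in auto)
  from pd_eqI[OF this] show ?thesis .
qed

section \<open>Cutoff functions\<close>

text \<open>\<open>flat 0\<close> is the classical smooth function that vanishes at 0 with all its
  derivatives. The powers in the denominator make the family closed under differentiation up to
  linear combinations.\<close>

definition flat :: "nat \<Rightarrow> real \<Rightarrow> real" where
  "flat n t = (if t > 0 then exp (- 1 / t) / t ^ n else 0)"

text \<open>The substitution y = 1/t turns the limit from the right into that of y^n / exp y at
  infinity.\<close>

lemma flat_tendsto_0: "(flat n \<longlongrightarrow> 0) (at 0)"
proof -
  have "((\<lambda>t. (inverse t) ^ n / exp (inverse t)) \<longlongrightarrow> 0) (at_right (0::real))"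
    by (rule filterlim_compose[OF tendsto_power_div_exp_0 filterlim_inverse_at_top_right])
  moreover have "eventually (\<lambda>t::real. (inverse t) ^ n / exp (inverse t) = flat n t) (at_right 0)"
    unfolding eventually_at_right_field
    by (rule exI[of _ 1]) (auto simp: flat_def exp_minus field_simps)
  ultimately have "(flat n \<longlongrightarrow> 0) (at_right 0)"
    using Lim_transform_eventually by blast
  moreover have "(flat n \<longlongrightarrow> 0) (at_left 0)"
  proof (rule Lim_transform_eventually[OF tendsto_const])
    show "\<forall>\<^sub>F t in at_left 0. 0 = flat n t"
      unfolding eventually_at_left_field by (rule exI[of _ "-1"]) (auto simp: flat_def)
  qed
  ultimately show ?thesis by (simp add: filterlim_split_at)
qed

lemma flat_deriv: "(flat n has_real_derivative 1 * flat (n + 2) t + (- real n) * flat (n + 1) t) (at t)"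
proof -
  consider "t > 0" | "t < 0" | "t = 0" by linarith
  then show ?thesis
  proof cases
    case 1
    have e: "((\<lambda>t. exp (- 1 / t)) has_real_derivative exp (- 1 / t) / t\<^sup>2) (at t)"
      using 1 by (auto intro!: derivative_eq_intros simp: power2_eq_square)
    have "(exp (- 1 / t) / t\<^sup>2 * t ^ n - exp (- 1 / t) * (real n * t ^ (n - 1))) / (t ^ n * t ^ n)
        = 1 * flat (n + 2) t + (- real n) * flat (n + 1) t"
      \<comment> \<open>The case split is due to the truncated exponent \<open>n - 1\<close>, which
        at \<open>n = 0\<close> carries the factor 0.\<close>
      using 1 by (cases n) (auto simp: flat_def divide_simps power2_eq_square, simp add: algebra_simps)
    moreover have d: "((\<lambda>t. t ^ n) has_real_derivative real n * t ^ (n - 1)) (at t)"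
      using DERIV_pow[of n t] by simp
    ultimately have *: "((\<lambda>t. exp (- 1 / t) / t ^ n) has_real_derivative
             1 * flat (n + 2) t + (- real n) * flat (n + 1) t) (at t)"
      using DERIV_divide[OF e d] 1 by simp
    show ?thesis
      by (rule has_field_derivative_transform_within_open[OF *, of "{0<..}"])
         (use 1 in \<open>auto simp: flat_def\<close>)
  next
    case 2
    have "((\<lambda>t. 0) has_real_derivative 0) (at t)" by simp
    then have "(flat n has_real_derivative 0) (at t)"
      by (rule has_field_derivative_transform_within_open[of _ _ _ "{..<0}"])
         (use 2 in \<open>auto simp: flat_def\<close>)
    then show ?thesis using 2 by (simp add: flat_def)
  next
    case 3
    \<comment> \<open>At 0 the difference quotient of \<open>flat n\<close> is
      \<open>flat (Suc n)\<close>, whose limit is already known.\<close>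
    have "((\<lambda>h. (flat n (0 + h) - flat n 0) / h) \<longlongrightarrow> 0) (at 0)"
      by (rule Lim_transform_eventually[OF flat_tendsto_0[of "Suc n"]])
         (auto simp: flat_def eventually_at intro: exI[of _ 1])
    then show ?thesis using 3 by (simp add: DERIV_def flat_def)
  qed
qed

lemma smooth_flat: "smooth g \<Longrightarrow> smooth (\<lambda>x. flat n (g x))"
proof (rule smooth_compose[where S = "range flat" and h = "flat n"])
  fix h assume "h \<in> range flat"
  then obtain n where "h = flat n" by auto
  then show "\<exists>h1\<in>range flat. \<exists>h2\<in>range flat. \<exists>a b. \<forall>t. (h has_real_derivative a * h1 t + b * h2 t) (at t)"
    using flat_deriv[of n] by blast
qed auto

text \<open>The profile is \<open>flat 0\<close> of 1 - |x - a|^2 / r^2, and the factor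
  \<open>exp 1\<close> makes its value at the centre equal to 1. The squared distance is spelled out
  in coordinates so that the smoothness rules apply term by term.\<close>

lemma smooth_bump:
  fixes a :: "real^'n"
  assumes "r > 0"
  obtains b :: "real^'n \<Rightarrow> real" where "smooth b" "\<And>x. 0 \<le> b x" "\<And>x. b x \<le> 1" "b a = 1"
    "\<And>x. x \<notin> cball a r \<Longrightarrow> b x = 0"
proof
  let ?q = "\<lambda>x. 1 - (1/r^2) * (\<Sum>i\<in>UNIV. (x$i - a$i) * (x$i - a$i))"
  let ?b = "\<lambda>x. exp 1 * flat 0 (?q x)"
  have q: "?q x = 1 - (dist x a / r)^2" for x
    by (simp add: dist_norm norm_vec_def L2_set_def power_divide sum_nonneg power2_eq_square[symmetric])
  show "smooth ?b"
    by (intro smooth_mult smooth_flat smooth_diff smooth_sum smooth_const smooth_nth)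
  show "0 \<le> ?b x" for x by (simp add: flat_def)
  show "?b x \<le> 1" for x
  proof (cases "?q x > 0")
    case True
    have "?q x \<le> 1" unfolding q by simp
    then have "1 \<le> 1 / ?q x" using True by simp
    then have "exp (1 + - 1 / ?q x) \<le> exp 0" by (subst exp_le_cancel_iff) simp
    then show ?thesis using True by (simp add: flat_def exp_add[symmetric])
  qed (simp add: flat_def)
  show "?b a = 1" by (simp add: flat_def exp_add[symmetric])
  show "?b x = 0" if "x \<notin> cball a r" for x
  proof -
    have "1 < dist x a / r" using that assms by (simp add: dist_commute)
    then have "?q x < 0" unfolding q by (simp add: one_less_power)
    then show ?thesis by (simp add: flat_def)
  qed
qed

text \<open>Finitely many sets on which some bump is at least 1/2 cover \<open>C\<close>, and their
  bumps are merged into one function. The value 1/2 in place of 1 suffices, since later only a lower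
  bound for the integral of the square is wanted.\<close>

lemma smooth_cutoff:
  fixes C U :: "(real^'n) set"
  assumes "compact C" "open U" "C \<subseteq> U"
  obtains \<theta> :: "real^'n \<Rightarrow> real" and K where "smooth \<theta>" "\<And>x. 0 \<le> \<theta> x" "\<And>x. \<theta> x \<le> 1"
    "\<And>x. x \<in> C \<Longrightarrow> 1/2 \<le> \<theta> x" "compact K" "K \<subseteq> U" "\<And>x. x \<notin> K \<Longrightarrow> \<theta> x = 0"
proof -
  have "\<exists>b W K. smooth b \<and> (\<forall>x. 0 \<le> b x \<and> b x \<le> 1) \<and> open W \<and> a \<in> W \<and> (\<forall>x\<in>W. 1/2 \<le> b x)
        \<and> compact K \<and> K \<subseteq> U \<and> (\<forall>x. x \<notin> K \<longrightarrow> b x = (0::real))" if "a \<in> C" for a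
  proof -
    have "a \<in> U" using assms(3) that by blast
    then obtain r where r: "r > 0" "cball a r \<subseteq> U"
      using assms(2) unfolding open_contains_cball by blast
    obtain b :: "real^'n \<Rightarrow> real" where b: "smooth b" "\<And>x. 0 \<le> b x" "\<And>x. b x \<le> 1" "b a = 1"
        "\<And>x. x \<notin> cball a r \<Longrightarrow> b x = 0" using smooth_bump[OF r(1)] by blast
    have "open {x. 1/2 < b x}"
      using open_Collect_less[OF continuous_on_const smooth_continuous[OF b(1)]] .
    then show ?thesis
      using b r by (intro exI[of _ b] exI[of _ "{x. 1/2 < b x}"] exI[of _ "cball a r"]) auto
  qed
  then have "\<exists>b. \<forall>a\<in>C. \<exists>W K. smooth (b a) \<and> (\<forall>x. 0 \<le> b a x \<and> b a x \<le> 1) \<and> open W \<and> a \<in> W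
      \<and> (\<forall>x\<in>W. 1/2 \<le> b a x) \<and> compact K \<and> K \<subseteq> U \<and> (\<forall>x. x \<notin> K \<longrightarrow> b a x = (0::real))"
    by (intro bchoice) blast
  then obtain b where "\<forall>a\<in>C. \<exists>W K. smooth (b a) \<and> (\<forall>x. 0 \<le> b a x \<and> b a x \<le> 1) \<and> open W \<and> a \<in> W
      \<and> (\<forall>x\<in>W. 1/2 \<le> b a x) \<and> compact K \<and> K \<subseteq> U \<and> (\<forall>x. x \<notin> K \<longrightarrow> b a x = (0::real))"
    by blast
  from bchoice[OF this] obtain W where "\<forall>a\<in>C. \<exists>K. smooth (b a) \<and> (\<forall>x. 0 \<le> b a x \<and> b a x \<le> 1)
      \<and> open (W a) \<and> a \<in> W a
      \<and> (\<forall>x\<in>W a. 1/2 \<le> b a x) \<and> compact K \<and> K \<subseteq> U \<and> (\<forall>x. x \<notin> K \<longrightarrow> b a x = (0::real))"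
    by blast
  from bchoice[OF this] obtain K where "\<forall>a\<in>C. smooth (b a) \<and> (\<forall>x. 0 \<le> b a x \<and> b a x \<le> 1)
      \<and> open (W a) \<and> a \<in> W a \<and> (\<forall>x\<in>W a. 1/2 \<le> b a x)
      \<and> compact (K a) \<and> K a \<subseteq> U \<and> (\<forall>x. x \<notin> K a \<longrightarrow> b a x = (0::real))"
    by blast
  then have bW: "\<And>a. a \<in> C \<Longrightarrow> smooth (b a)"
      "\<And>a x. a \<in> C \<Longrightarrow> 0 \<le> b a x \<and> b a x \<le> (1::real)"
      "\<And>a. a \<in> C \<Longrightarrow> open (W a)" "\<And>a. a \<in> C \<Longrightarrow> a \<in> W a" "\<And>a x. a \<in> C \<Longrightarrow> x \<in> W a \<Longrightarrow> 1/2 \<le> b a x"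
      "\<And>a. a \<in> C \<Longrightarrow> compact (K a)" "\<And>a. a \<in> C \<Longrightarrow> K a \<subseteq> U" "\<And>a x. a \<in> C \<Longrightarrow> x \<notin> K a \<Longrightarrow> b a x = 0"
    by simp_all
  obtain A where A: "A \<subseteq> C" "finite A" "C \<subseteq> (\<Union>a\<in>A. W a)"
  proof (rule compactE_image[OF assms(1), of C W])
    show "C \<subseteq> \<Union> (W ` C)" using bW(4) by blast
  qed (use bW(3) in auto)
  have "\<exists>\<theta> L. smooth \<theta> \<and> (\<forall>x. 0 \<le> \<theta> x \<and> \<theta> x \<le> (1::real)) \<and> (\<forall>x\<in>(\<Union>a\<in>A. W a). 1/2 \<le> \<theta> x)
        \<and> compact L \<and> L \<subseteq> U \<and> (\<forall>x. x \<notin> L \<longrightarrow> \<theta> x = 0)"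
    using A(2,1)
  proof (induction A)
    case empty
    show ?case by (rule exI[of _ "\<lambda>x. 0"], rule exI[of _ "{}"]) (auto simp: smooth_const)
  next
    case (insert a A)
    then obtain \<theta> L where \<theta>: "smooth \<theta>" "\<And>x. 0 \<le> \<theta> x \<and> \<theta> x \<le> (1::real)" 
        "\<And>x. x\<in>(\<Union>a\<in>A. W a) \<Longrightarrow> 1/2 \<le> \<theta> x" "compact L" "L \<subseteq> U" "\<And>x. x \<notin> L \<Longrightarrow> \<theta> x = 0"
      by (metis insert_subset)
    \<comment> \<open>A smooth substitute for the maximum: 1 - (1 - u)(1 - v) stays in [0, 1] and
      dominates both u and v.\<close>
    let ?t = "\<lambda>x. 1 - (1 - \<theta> x) * (1 - b a x)"
    have a: "a \<in> C" using insert by auto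
    have t: "?t x = \<theta> x + (1 - \<theta> x) * b a x" "?t x = b a x + \<theta> x * (1 - b a x)" for x
      by (auto simp: algebra_simps)
    have t_ge: "\<theta> x \<le> ?t x" "b a x \<le> ?t x" for x
      unfolding atomize_conj using \<theta>(2)[of x] bW(2)[OF a, of x] t[of x]
      by (metis add.commute add_increasing2 diff_ge_0_iff_ge mult_nonneg_nonneg order_refl)
    have t_le: "?t x \<le> 1" for x
      using \<theta>(2)[of x] bW(2)[OF a, of x] by simp
    have "smooth ?t"
      by (intro smooth_diff smooth_mult smooth_const \<theta>(1) bW(1)[OF a])
    moreover have "\<forall>x. 0 \<le> ?t x \<and> ?t x \<le> 1"
      using t_ge(1) t_le \<theta>(2) order_trans by blast
    moreover have "\<forall>x\<in>(\<Union>a\<in>insert a A. W a). 1/2 \<le> ?t x"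
    proof
      fix x assume "x \<in> (\<Union>a\<in>insert a A. W a)"
      then consider "1/2 \<le> b a x" | "1/2 \<le> \<theta> x" using \<theta>(3) bW(5)[OF a] by blast
      then show "1/2 \<le> ?t x" by cases (use t_ge[of x] in linarith)+
    qed
    moreover have "compact (L \<union> K a)" "L \<union> K a \<subseteq> U" using \<theta>(4,5) bW(6,7)[OF a] by auto
    moreover have "\<forall>x. x \<notin> L \<union> K a \<longrightarrow> ?t x = 0" using \<theta>(6) bW(8)[OF a] by simp
    ultimately show ?case by blast
  qed
  then show thesis using that A(3) by (metis subset_iff)
qed

section \<open>Partial derivatives and integration\<close>

lemma smooth_line_derivative:
  fixes f :: "real^'n \<Rightarrow> real"
  assumes "smooth f"
  shows "((\<lambda>t. f (x + t *\<^sub>R axis j 1)) has_real_derivative pd j f (x + t *\<^sub>R axis j 1)) (at t)"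
proof -
  let ?F = "frechet_derivative f (at (x + t *\<^sub>R axis j 1))"
  have 1: "((\<lambda>t. x + t *\<^sub>R axis j 1) has_derivative (\<lambda>h. h *\<^sub>R axis j 1)) (at t)"
    by (auto intro!: derivative_eq_intros)
  have 2: "(f has_derivative ?F) (at (x + t *\<^sub>R axis j 1))"
    using smooth_has_derivative[OF assms] .
  from diff_chain_at[OF 1 2]
  have "((\<lambda>t. f (x + t *\<^sub>R axis j 1)) has_derivative (\<lambda>h. ?F (h *\<^sub>R axis j 1))) (at t)"
    by (simp add: o_def)
  moreover have "(\<lambda>h. ?F (h *\<^sub>R axis j 1)) = (*) (?F (axis j 1))"
    using has_derivative_linear[OF 2] by (auto simp: linear_cmul)
  ultimately show ?thesis by (simp add: has_field_derivative_def pd_def)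
qed

lemma smooth_line_MVT:
  fixes f :: "real^'n \<Rightarrow> real"
  assumes "smooth f" "h > 0"
  obtains t where "0 < t" "t < h" "f (x + h *\<^sub>R axis j 1) - f x = h * pd j f (x + t *\<^sub>R axis j 1)"
  using MVT2[of 0 h "\<lambda>t. f (x + t *\<^sub>R axis j 1)" "\<lambda>t. pd j f (x + t *\<^sub>R axis j 1)"]
    smooth_line_derivative[OF assms(1)] assms(2) by auto

text \<open>The mean value theorem is used twice: in direction i for the increment of
  \<open>f\<close> in direction j, then in direction j for \<open>pd i f\<close>. The point of it is
  that the left-hand side is symmetric in i and j.\<close>

lemma second_difference_MVT:
  fixes f :: "real^'n \<Rightarrow> real"
  assumes "smooth f" "h > 0"
  obtains y where "dist y x \<le> 2 * h"
    "f (x + h *\<^sub>R axis i 1 + h *\<^sub>R axis j 1) - f (x + h *\<^sub>R axis i 1) - f (x + h *\<^sub>R axis j 1) + f x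
      = h\<^sup>2 * pd j (pd i f) y"
proof -
  let ?g = "\<lambda>t. f ((x + h *\<^sub>R axis j 1) + t *\<^sub>R axis i 1) - f (x + t *\<^sub>R axis i 1)"
  have "(?g has_real_derivative
      (pd i f ((x + h *\<^sub>R axis j 1) + t *\<^sub>R axis i 1) - pd i f (x + t *\<^sub>R axis i 1))) (at t)" for t
    by (intro DERIV_diff smooth_line_derivative assms)
  from MVT2[of 0 h ?g, OF assms(2) this] obtain s where s: "0 < s" "s < h" and
    es: "?g h - ?g 0 = h * (pd i f ((x + h *\<^sub>R axis j 1) + s *\<^sub>R axis i 1) - pd i f (x + s *\<^sub>R axis i 1))"
    by auto
  obtain t where t: "0 < t" "t < h" and et:
    "pd i f ((x + s *\<^sub>R axis i 1) + h *\<^sub>R axis j 1) - pd i f (x + s *\<^sub>R axis i 1)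
      = h * pd j (pd i f) ((x + s *\<^sub>R axis i 1) + t *\<^sub>R axis j 1)"
    using smooth_line_MVT[OF smooth_pd[OF assms(1)] assms(2)] by blast
  have "dist ((x + s *\<^sub>R axis i 1) + t *\<^sub>R axis j 1) x \<le> norm (s *\<^sub>R axis i (1::real)) + norm (t *\<^sub>R axis j (1::real))"
    by (simp add: dist_norm add.assoc norm_triangle_ineq del: norm_scaleR)
  also have "\<dots> \<le> 2 * h" using s t by simp
  finally have "dist ((x + s *\<^sub>R axis i 1) + t *\<^sub>R axis j 1) x \<le> 2 * h" .
  then show thesis
    using that es et by (simp add: ac_simps power2_eq_square algebra_simps)
qed

text \<open>One and the same second difference equals h^2 times either mixed derivative, each taken
  at some point within 2h of \<open>x\<close>; continuity does the rest. The linear constraint on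
  the potential fields rests on this symmetry.\<close>

lemma pd_commute:
  fixes f :: "real^'n \<Rightarrow> real"
  assumes "smooth f"
  shows "pd i (pd j f) x = pd j (pd i f) x"
proof (rule ccontr)
  assume ne: "pd i (pd j f) x \<noteq> pd j (pd i f) x"
  \<comment> \<open>Half of the gap: two values within \<open>e\<close> of the two sides cannot
    coincide.\<close>
  define e where "e = \<bar>pd i (pd j f) x - pd j (pd i f) x\<bar> / 2"
  have e: "e > 0" using ne by (simp add: e_def)
  have "continuous_on UNIV (pd i (pd j f))" "continuous_on UNIV (pd j (pd i f))"
    by (intro smooth_continuous smooth_pd assms)+
  then have "isCont (pd i (pd j f)) x" "isCont (pd j (pd i f)) x"
    by (auto simp: continuous_on_eq_continuous_at)
  then obtain d1 d2 where d: "d1 > 0" "d2 > 0"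
      "\<And>y. dist y x < d1 \<Longrightarrow> dist (pd i (pd j f) y) (pd i (pd j f) x) < e"
      "\<And>y. dist y x < d2 \<Longrightarrow> dist (pd j (pd i f) y) (pd j (pd i f) x) < e"
    using e unfolding continuous_at_eps_delta dist_norm by metis
  define h where "h = min d1 d2 / 4"
  have h: "h > 0" "2 * h < d1" "2 * h < d2" using d by (auto simp: h_def)
  obtain y where y: "dist y x \<le> 2 * h"
    "f (x + h *\<^sub>R axis i 1 + h *\<^sub>R axis j 1) - f (x + h *\<^sub>R axis i 1) - f (x + h *\<^sub>R axis j 1) + f x
      = h\<^sup>2 * pd j (pd i f) y" using second_difference_MVT[OF assms h(1)] by blast
  obtain z where z: "dist z x \<le> 2 * h"
    "f (x + h *\<^sub>R axis j 1 + h *\<^sub>R axis i 1) - f (x + h *\<^sub>R axis j 1) - f (x + h *\<^sub>R axis i 1) + f x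
      = h\<^sup>2 * pd i (pd j f) z" using second_difference_MVT[OF assms h(1)] by blast
  have "h\<^sup>2 * pd j (pd i f) y = h\<^sup>2 * pd i (pd j f) z"
    using y(2) z(2) by (simp add: algebra_simps)
  then have "pd j (pd i f) y = pd i (pd j f) z" using h by simp
  moreover have "dist (pd j (pd i f) y) (pd j (pd i f) x) < e" "dist (pd i (pd j f) z) (pd i (pd j f) x) < e"
    using d(3)[of z] d(4)[of y] y(1) z(1) h by auto
  ultimately show False unfolding dist_real_def e_def by argo
qed

section \<open>Compactly supported functions and integration by parts\<close>

lemma bounded_compact_support:
  fixes f :: "'a::topological_space \<Rightarrow> 'b::real_normed_vector"
  assumes "continuous_on K f" "compact K" "\<And>x. x \<notin> K \<Longrightarrow> f x = 0"
  obtains M where "M > 0" "\<And>x. norm (f x) \<le> M"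
proof -
  have "bounded (f ` K)" using assms compact_continuous_image compact_imp_bounded by blast
  then obtain M where "M > 0" "\<And>x. x \<in> K \<Longrightarrow> norm (f x) \<le> M"
    unfolding bounded_pos by auto
  then show thesis using that[of M] assms(3) by (metis less_imp_le norm_zero)
qed

lemma integrable_compact_support:
  fixes f :: "'a::euclidean_space \<Rightarrow> 'b::{banach,second_countable_topology}"
  assumes "continuous_on UNIV f" "compact K" "\<And>x. x \<notin> K \<Longrightarrow> f x = 0"
  shows "integrable lborel f"
proof -
  have "integrable lborel (\<lambda>x. indicator K x *\<^sub>R f x)"
    using assms by (intro borel_integrable_compact) (auto intro: continuous_on_subset)
  moreover have "(\<lambda>x. indicator K x *\<^sub>R f x) = f" using assms by (auto simp: indicator_def)
  ultimately show ?thesis by simp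
qed

lemma smooth_measurable: "smooth f \<Longrightarrow> f \<in> borel_measurable borel"
  by (intro borel_measurable_continuous_onI smooth_continuous)

text \<open>By translation invariance the difference quotients have integral 0, and dominated
  convergence passes this on to the derivative.\<close>

lemma integral_pd_eq_0:
  fixes f :: "real^'n \<Rightarrow> real"
  assumes f: "smooth f" and K: "compact K" "\<And>x. x \<notin> K \<Longrightarrow> f x = 0"
  shows "(\<integral>x. pd j f x \<partial>lborel) = 0"
proof -
  let ?e = "axis j 1 :: real^'n"
  define s where "s n x = (f (x + (1 / real (Suc n)) *\<^sub>R ?e) - f x) / (1 / real (Suc n))" for n x
  have f0: "pd j f x = 0" if "x \<notin> K" for x
    using pd_zero_outside[OF compact_imp_closed[OF K(1)] K(2) that] .
  obtain M where M: "M > 0" "\<And>x. norm (pd j f x) \<le> M"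
    using bounded_compact_support[OF smooth_continuous[OF smooth_pd[OF f]] K(1) f0] by blast
  obtain R where R: "R > 0" "K \<subseteq> cball 0 R"
    using compact_imp_bounded[OF K(1)] unfolding bounded_pos by (meson mem_cball_0 subsetI)
  have fi: "integrable lborel f" by (rule integrable_compact_support[OF smooth_continuous[OF f] K])
  have fm[measurable]: "f \<in> borel_measurable borel"
    using smooth_measurable[OF f] .
  have shift: "integrable lborel (\<lambda>x. f (x + c))" "(\<integral>x. f (x + c) \<partial>lborel) = (\<integral>x. f x \<partial>lborel)" for c
  proof -
    have "integrable (distr lborel borel ((+) c)) f"
      by (subst lborel_distr_plus) (rule fi)
    then show "integrable lborel (\<lambda>x. f (x + c))"
      by (subst (asm) integrable_distr_eq) (auto simp: add.commute)
    have "(\<integral>x. f x \<partial>lborel) = (\<integral>x. f x \<partial>(distr lborel borel ((+) c)))"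
      by (subst lborel_distr_plus) (rule refl)
    also have "\<dots> = (\<integral>x. f (x + c) \<partial>lborel)"
      by (subst integral_distr) (auto simp: add.commute)
    finally show "(\<integral>x. f (x + c) \<partial>lborel) = (\<integral>x. f x \<partial>lborel)" by simp
  qed
  have s0: "(\<integral>x. s n x \<partial>lborel) = 0" for n
    unfolding s_def integral_divide_zero
    by (subst Bochner_Integration.integral_diff) (auto simp: shift fi)
  have "(\<lambda>n. \<integral>x. s n x \<partial>lborel) \<longlonglongrightarrow> (\<integral>x. pd j f x \<partial>lborel)"
  proof (rule integral_dominated_convergence[where w = "\<lambda>x. indicator (cball 0 (R+1)) x *\<^sub>R M"])
    show "pd j f \<in> borel_measurable lborel"
      using smooth_measurable[OF smooth_pd[OF f]] by simp
    show "s n \<in> borel_measurable lborel" for n unfolding s_def by measurable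
    show "integrable lborel (\<lambda>x::real^'n. indicator (cball 0 (R+1)) x *\<^sub>R M)"
      by (intro borel_integrable_compact) auto
    show "AE x in lborel. (\<lambda>n. s n x) \<longlonglongrightarrow> pd j f x"
    proof (rule AE_I2)
      fix x
      have "((\<lambda>h. (f (x + h *\<^sub>R ?e) - f x) / h) \<longlongrightarrow> pd j f x) (at 0)"
        using smooth_line_derivative[OF f, of x j 0] by (simp add: DERIV_def)
      moreover have "filterlim (\<lambda>n. 1 / real (Suc n)) (at 0) sequentially"
        using LIMSEQ_Suc[OF lim_1_over_n] by (auto simp: filterlim_at)
      ultimately show "(\<lambda>n. s n x) \<longlonglongrightarrow> pd j f x"
        unfolding s_def using filterlim_compose by blast
    qed
    \<comment> \<open>The mean value theorem bounds the quotient by \<open>M\<close>. The increments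
      are at most 1, so the quotient vanishes outside the ball of radius R + 1.\<close>
    show "AE x in lborel. norm (s n x) \<le> indicator (cball 0 (R+1)) x *\<^sub>R M" for n
    proof (rule AE_I2)
      fix x
      let ?h = "1 / real (Suc n)"
      have h: "0 < ?h" "?h \<le> 1" by auto
      obtain t where "f (x + ?h *\<^sub>R ?e) - f x = ?h * pd j f (x + t *\<^sub>R ?e)"
        using smooth_line_MVT[OF f h(1)] by blast
      then have "s n x = pd j f (x + t *\<^sub>R ?e)" by (simp add: s_def)
      then have 1: "norm (s n x) \<le> M" using M by simp
      show "norm (s n x) \<le> indicator (cball 0 (R+1)) x *\<^sub>R M"
      proof (cases "x \<in> cball 0 (R+1)")
        case False
        then have nx: "norm x > R + 1" by simp
        have "norm x \<le> norm (x + ?h *\<^sub>R ?e) + norm (?h *\<^sub>R ?e)"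
          by (metis add_diff_cancel_right' norm_triangle_ineq4)
        moreover have "norm (?h *\<^sub>R ?e) \<le> 1" by simp
        ultimately have "norm x \<le> norm (x + ?h *\<^sub>R ?e) + 1" by linarith
        then have "x + ?h *\<^sub>R ?e \<notin> K" "x \<notin> K" using nx R by auto
        then show ?thesis using K(2) M by (simp add: s_def)
      qed (use 1 in simp)
    qed
  qed
  then show ?thesis using s0 LIMSEQ_unique[OF tendsto_const] by fastforce
qed

lemma integration_by_parts:
  fixes f g :: "real^'n \<Rightarrow> real"
  assumes f: "smooth f" and g: "smooth g" and K: "compact K" "\<And>x. x \<notin> K \<Longrightarrow> g x = 0"
  shows "(\<integral>x. f x * pd j g x \<partial>lborel) = - (\<integral>x. pd j f x * g x \<partial>lborel)"
proof -
  have g0: "pd j g x = 0" if "x \<notin> K" for x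
    using pd_zero_outside[OF compact_imp_closed[OF K(1)] K(2) that] .
  have i: "integrable lborel (\<lambda>x. f x * pd j g x)" "integrable lborel (\<lambda>x. pd j f x * g x)"
    by (rule integrable_compact_support[where K = K];
        use K g0 in \<open>auto intro!: smooth_continuous smooth_mult smooth_pd f g\<close>)+
  have "(\<integral>x. pd j (\<lambda>x. f x * g x) x \<partial>lborel) = 0"
    using K by (intro integral_pd_eq_0[of _ K] smooth_mult f g) auto
  moreover have "pd j (\<lambda>x. f x * g x) x = f x * pd j g x + pd j f x * g x" for x
    by (intro pd_mult smooth_differentiable f g)
  ultimately show ?thesis using Bochner_Integration.integral_add[OF i] by simp
qed

section \<open>The rank-one convex hull\<close>

lemma rc_hullD:
  assumes "\<eta> \<in> rc_hull K_set" "rank_one_convex f" "\<And>\<zeta>. \<zeta> \<in> K_set \<Longrightarrow> f \<zeta> \<le> c"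
  shows "f \<eta> \<le> c"
proof -
  have "f \<eta> \<le> (SUP \<zeta>\<in>K_set. f \<zeta>)" using assms(1,2) by (auto simp: rc_hull_def)
  also have "\<dots> \<le> c" by (rule cSUP_least) (use assms(3) in \<open>auto simp: K_set_def\<close>)
  finally show ?thesis .
qed

lemma A_entries:
  "A1 $ 1 $ 1 = 3" "A1 $ 1 $ 2 = 0" "A1 $ 2 $ 1 = 0" "A1 $ 2 $ 2 = -1"
  "A2 $ 1 $ 1 = 1" "A2 $ 1 $ 2 = 0" "A2 $ 2 $ 1 = 0" "A2 $ 2 $ 2 = 3"
  "A3 $ 1 $ 1 = -3" "A3 $ 1 $ 2 = 0" "A3 $ 2 $ 1 = 0" "A3 $ 2 $ 2 = 1"
  "A4 $ 1 $ 1 = -1" "A4 $ 1 $ 2 = 0" "A4 $ 2 $ 1 = 0" "A4 $ 2 $ 2 = -3"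
  by (simp_all add: A1_def A2_def A3_def A4_def)


text \<open>If both means are positive, their product is the mean of the products minus t(1 - t)
  times the product of the differences, which \<open>d\<close> controls. The difficulty is an
  endpoint with both coordinates negative, where the product is positive but the product of the
  positive parts is 0; there the other endpoint alone dominates.\<close>

lemma pos_part_product:
  fixes t x1 x2 y1 y2 :: real
  assumes t: "0 \<le> t" "t \<le> 1" and d: "- ((x1 - x2) * (y1 - y2)) \<le> q" and q: "0 \<le> q"
  shows "max 0 (t * x1 + (1 - t) * x2) * max 0 (t * y1 + (1 - t) * y2)
    \<le> t * (max 0 x1 * max 0 y1) + (1 - t) * (max 0 x2 * max 0 y2) + t * (1 - t) * q"
proof -
  let ?x = "t * x1 + (1 - t) * x2" and ?y = "t * y1 + (1 - t) * y2"
  have p: "0 \<le> max 0 x1 * max 0 y1" "0 \<le> max 0 x2 * max 0 y2" "0 \<le> t * (1 - t) * q"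
    using t q by auto
  have tp: "0 \<le> t * (max 0 x1 * max 0 y1)" "0 \<le> (1 - t) * (max 0 x2 * max 0 y2)"
    using p t by (auto intro: mult_nonneg_nonneg)
  show ?thesis
  proof (cases "?x \<le> 0 \<or> ?y \<le> 0")
    case True
    then have "max 0 ?x * max 0 ?y = 0" by (auto simp: max_def)
    then show ?thesis using tp p(3) by linarith
  next
    case False
    then have pos: "?x > 0" "?y > 0" by auto
    have eq: "max 0 ?x * max 0 ?y = ?x * ?y" using pos by simp
    have id: "?x * ?y = t * (x1 * y1) + (1 - t) * (x2 * y2) + t * (1 - t) * (- ((x1 - x2) * (y1 - y2)))"
      by (simp add: algebra_simps)
    have le: "t * (1 - t) * (- ((x1 - x2) * (y1 - y2))) \<le> t * (1 - t) * q"
      using t d by (intro mult_left_mono) auto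
    have mx: "a * b \<le> max 0 a * max 0 b" if "\<not> (a < 0 \<and> b < 0)" for a b :: real
      using that by (auto simp: max_def mult_le_0_iff)
    \<comment> \<open>For the case that one endpoint only lowers both means: the product is then at
      most c^2 a b, and c^2 \<le> c restores the weight of the convex combination.\<close>
    have neg: "?x * ?y \<le> c * (max 0 a * max 0 b)" if "?x \<le> c * a" "?y \<le> c * b" "0 \<le> c" "c \<le> 1" for a b c
    proof -
      have ab: "0 \<le> a" "0 \<le> b"
        using pos that by (smt (verit) mult_nonneg_nonpos)+
      have "?x * ?y \<le> (c * a) * (c * b)" using that pos by (intro mult_mono) auto
      also have "\<dots> = c * (c * (a * b))" by simp
      also have "\<dots> \<le> c * (a * b)" using that ab
        by (intro mult_left_mono) (auto intro: mult_left_le_one_le)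
      finally show ?thesis using ab by simp
    qed
    consider "x1 < 0 \<and> y1 < 0" | "x2 < 0 \<and> y2 < 0" | "\<not> (x1 < 0 \<and> y1 < 0)" "\<not> (x2 < 0 \<and> y2 < 0)"
      by blast
    then show ?thesis
    proof cases
      case 1
      then have "t * x1 \<le> 0" "t * y1 \<le> 0" using t by (auto simp: mult_le_0_iff)
      then have "?x * ?y \<le> (1 - t) * (max 0 x2 * max 0 y2)" using t by (intro neg) auto
      then show ?thesis using eq tp p(3) by linarith
    next
      case 2
      then have "(1 - t) * x2 \<le> 0" "(1 - t) * y2 \<le> 0" using t by (auto simp: mult_le_0_iff)
      then have "?x * ?y \<le> t * (max 0 x1 * max 0 y1)" using t by (intro neg) auto
      then show ?thesis using eq tp p(3) by linarith
    next
      case 3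
      have "t * (x1 * y1) \<le> t * (max 0 x1 * max 0 y1)" "(1 - t) * (x2 * y2) \<le> (1 - t) * (max 0 x2 * max 0 y2)"
        using 3 t mx by (auto intro!: mult_left_mono)
      then show ?thesis using eq id le by linarith
    qed
  qed
qed

lemma convex_square_identity:
  fixes t u v :: real
  shows "(t * u + (1 - t) * v)\<^sup>2 = t * u\<^sup>2 + (1 - t) * v\<^sup>2 - t * (1 - t) * (u - v)\<^sup>2"
  by (simp add: power2_eq_square algebra_simps)

text \<open>On a rank-one line the second difference of \<open>\<xi>\<^sub>1\<^sub>1 \<xi>\<^sub>2\<^sub>2\<close> equals that of \<open>\<xi>\<^sub>1\<^sub>2 \<xi>\<^sub>2\<^sub>1\<close>, which the
  convex quadratic term dominates.\<close>

lemma rank_one_convex_corner: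
  assumes "a\<^sup>2 = 1" "c\<^sup>2 = 1"
  shows "rank_one_convex (\<lambda>\<xi>. max 0 (a * \<xi> $ 1 $ 1 + b) * max 0 (c * \<xi> $ 2 $ 2 + d)
    + ((\<xi> $ 1 $ 2)\<^sup>2 + (\<xi> $ 2 $ 1)\<^sup>2) / 2)"
  unfolding rank_one_convex_def
proof (intro allI impI ballI)
  fix \<xi> \<zeta> :: "real^2^2" and t :: real
  assume r: "rank (\<xi> - \<zeta>) = 1" and t: "t \<in> {0..1}"
  define D where "D = \<xi> - \<zeta>"
  have "det D = 0" using r by (simp add: D_def det_eq_0_rank)
  then have det: "D $ 1 $ 1 * D $ 2 $ 2 = D $ 1 $ 2 * D $ 2 $ 1" by (simp add: det_2)
  let ?q = "((D $ 1 $ 2)\<^sup>2 + (D $ 2 $ 1)\<^sup>2) / 2"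
  let ?x1 = "a * \<xi> $ 1 $ 1 + b" and ?x2 = "a * \<zeta> $ 1 $ 1 + b"
  let ?y1 = "c * \<xi> $ 2 $ 2 + d" and ?y2 = "c * \<zeta> $ 2 $ 2 + d"
  have "(?x1 - ?x2) * (?y1 - ?y2) = (a * c) * (D $ 1 $ 2 * D $ 2 $ 1)"
    unfolding det[symmetric] by (simp add: D_def algebra_simps)
  moreover have "a * c = 1 \<or> a * c = -1"
    using assms unfolding power2_eq_1_iff by auto
  moreover have "\<bar>D $ 1 $ 2 * D $ 2 $ 1\<bar> \<le> ?q"
    using sum_squares_bound[of "\<bar>D $ 1 $ 2\<bar>" "\<bar>D $ 2 $ 1\<bar>"] by (simp add: abs_mult)
  ultimately have q: "- ((?x1 - ?x2) * (?y1 - ?y2)) \<le> ?q" by auto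
  have lin: "a * (t *\<^sub>R \<xi> + (1 - t) *\<^sub>R \<zeta>) $ 1 $ 1 + b = t * ?x1 + (1 - t) * ?x2"
    "c * (t *\<^sub>R \<xi> + (1 - t) *\<^sub>R \<zeta>) $ 2 $ 2 + d = t * ?y1 + (1 - t) * ?y2"
    by (simp_all add: algebra_simps)
  \<comment> \<open>The convexity of the squares is used quantitatively: their deficit t(1 - t)
    times \<open>?q\<close> is exactly the loss that \<open>pos_part_product\<close>
    permits.\<close>
  have sq: "((t *\<^sub>R \<xi> + (1 - t) *\<^sub>R \<zeta>) $ i $ j)\<^sup>2
      = t * (\<xi> $ i $ j)\<^sup>2 + (1 - t) * (\<zeta> $ i $ j)\<^sup>2 - t * (1 - t) * (D $ i $ j)\<^sup>2" for i j
    using convex_square_identity by (simp add: D_def)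
  have "max 0 (t * ?x1 + (1 - t) * ?x2) * max 0 (t * ?y1 + (1 - t) * ?y2)
    \<le> t * (max 0 ?x1 * max 0 ?y1) + (1 - t) * (max 0 ?x2 * max 0 ?y2) + t * (1 - t) * ?q"
    using t by (intro pos_part_product q) auto
  then show "max 0 (a * (t *\<^sub>R \<xi> + (1 - t) *\<^sub>R \<zeta>) $ 1 $ 1 + b) * max 0 (c * (t *\<^sub>R \<xi> + (1 - t) *\<^sub>R \<zeta>) $ 2 $ 2 + d)
      + (((t *\<^sub>R \<xi> + (1 - t) *\<^sub>R \<zeta>) $ 1 $ 2)\<^sup>2 + ((t *\<^sub>R \<xi> + (1 - t) *\<^sub>R \<zeta>) $ 2 $ 1)\<^sup>2) / 2
    \<le> t * (max 0 ?x1 * max 0 ?y1 + ((\<xi> $ 1 $ 2)\<^sup>2 + (\<xi> $ 2 $ 1)\<^sup>2) / 2)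
      + (1 - t) * (max 0 ?x2 * max 0 ?y2 + ((\<zeta> $ 1 $ 2)\<^sup>2 + (\<zeta> $ 2 $ 1)\<^sup>2) / 2)"
    unfolding lin sq by (simp add: field_simps)
qed

lemma rank_one_convex_entry: "rank_one_convex (\<lambda>\<xi>. c * \<xi> $ i $ j)"
  unfolding rank_one_convex_def by (auto simp: algebra_simps)

text \<open>The entries are linear functions and yield the box and the vanishing off-diagonal part.
  Four corner functions then remove the open quadrants with vertices (1,-1), (1,1), (-1,1) and
  (-1,-1), none of which meets \<open>K_set\<close>. What remains of the box is the square [-1,1]^2
  with a segment from each vertex to a point of \<open>K_set\<close>. Only this upper bound for the
  hull is used.\<close>

lemma rc_hull_K_set:
  assumes "\<eta> \<in> rc_hull K_set"
  shows "\<eta> $ 1 $ 2 = 0" "\<eta> $ 2 $ 1 = 0"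
    and "\<bar>\<eta> $ 1 $ 1\<bar> \<le> 3" "\<bar>\<eta> $ 2 $ 2\<bar> \<le> 3"
    and "\<eta> $ 1 $ 1 \<le> 1 \<or> \<eta> $ 2 $ 2 \<le> -1" "1 \<le> \<eta> $ 1 $ 1 \<or> \<eta> $ 2 $ 2 \<le> 1"
    and "-1 \<le> \<eta> $ 1 $ 1 \<or> 1 \<le> \<eta> $ 2 $ 2" "\<eta> $ 1 $ 1 \<le> -1 \<or> -1 \<le> \<eta> $ 2 $ 2"
proof -
  have e: "c * \<eta> $ i $ j \<le> m" if "\<And>\<zeta>. \<zeta> \<in> K_set \<Longrightarrow> c * \<zeta> $ i $ j \<le> m" for c m i j
    using rc_hullD[OF assms rank_one_convex_entry, of c i j m] that .
  have "1 * \<eta> $ 1 $ 2 \<le> 0" "-1 * \<eta> $ 1 $ 2 \<le> 0" "1 * \<eta> $ 2 $ 1 \<le> 0" "-1 * \<eta> $ 2 $ 1 \<le> 0"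
    by (intro e; auto simp: K_set_def A_entries)+
  then show z: "\<eta> $ 1 $ 2 = 0" "\<eta> $ 2 $ 1 = 0" by auto
  have "1 * \<eta> $ 1 $ 1 \<le> 3" "-1 * \<eta> $ 1 $ 1 \<le> 3" "1 * \<eta> $ 2 $ 2 \<le> 3" "-1 * \<eta> $ 2 $ 2 \<le> 3"
    by (intro e; auto simp: K_set_def A_entries)+
  then show "\<bar>\<eta> $ 1 $ 1\<bar> \<le> 3" "\<bar>\<eta> $ 2 $ 2\<bar> \<le> 3" by auto
  have corner: "a * \<eta> $ 1 $ 1 + b \<le> 0 \<or> c * \<eta> $ 2 $ 2 + d \<le> 0"
    if ac: "a\<^sup>2 = 1" "c\<^sup>2 = 1" and K: "\<And>\<zeta>. \<zeta> \<in> K_set \<Longrightarrow> a * \<zeta> $ 1 $ 1 + b \<le> 0 \<or> c * \<zeta> $ 2 $ 2 + d \<le> 0"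
    for a b c d
  proof -
    have "max 0 (a * \<eta> $ 1 $ 1 + b) * max 0 (c * \<eta> $ 2 $ 2 + d)
        + ((\<eta> $ 1 $ 2)\<^sup>2 + (\<eta> $ 2 $ 1)\<^sup>2) / 2 \<le> 0"
    proof (rule rc_hullD[OF assms rank_one_convex_corner[OF ac]])
      fix \<zeta> assume \<zeta>: "\<zeta> \<in> K_set"
      have "\<zeta> $ 1 $ 2 = 0" "\<zeta> $ 2 $ 1 = 0" using \<zeta> by (auto simp: K_set_def A_entries)
      then show "max 0 (a * \<zeta> $ 1 $ 1 + b) * max 0 (c * \<zeta> $ 2 $ 2 + d)
          + ((\<zeta> $ 1 $ 2)\<^sup>2 + (\<zeta> $ 2 $ 1)\<^sup>2) / 2 \<le> 0"
        using K[OF \<zeta>] by (auto simp: max_def)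
    qed
    then show ?thesis using z by (auto simp: max_def mult_le_0_iff split: if_splits)
  qed
  have "1 * \<eta> $ 1 $ 1 + -1 \<le> 0 \<or> 1 * \<eta> $ 2 $ 2 + 1 \<le> 0"
    by (rule corner) (auto simp: K_set_def A_entries)
  then show "\<eta> $ 1 $ 1 \<le> 1 \<or> \<eta> $ 2 $ 2 \<le> -1" by auto
  have "-1 * \<eta> $ 1 $ 1 + 1 \<le> 0 \<or> 1 * \<eta> $ 2 $ 2 + -1 \<le> 0"
    by (rule corner) (auto simp: K_set_def A_entries)
  then show "1 \<le> \<eta> $ 1 $ 1 \<or> \<eta> $ 2 $ 2 \<le> 1" by auto
  have "-1 * \<eta> $ 1 $ 1 + -1 \<le> 0 \<or> -1 * \<eta> $ 2 $ 2 + 1 \<le> 0"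
    by (rule corner) (auto simp: K_set_def A_entries)
  then show "-1 \<le> \<eta> $ 1 $ 1 \<or> 1 \<le> \<eta> $ 2 $ 2" by auto
  have "1 * \<eta> $ 1 $ 1 + 1 \<le> 0 \<or> -1 * \<eta> $ 2 $ 2 + -1 \<le> 0"
    by (rule corner) (auto simp: K_set_def A_entries)
  then show "\<eta> $ 1 $ 1 \<le> -1 \<or> -1 \<le> \<eta> $ 2 $ 2" by auto
qed

text \<open>\<open>hull_nbhd s\<close> is an open neighbourhood of the rank-one convex hull of \<open>K_set\<close>: a square with
  four arms. Away from \<open>near_K s\<close> each of its points is the midpoint of an axis-parallel segment
  of length \<open>s\<close> inside it.\<close>

definition tartar_cross :: "real \<Rightarrow> real \<Rightarrow> real \<Rightarrow> bool" where
  "tartar_cross s x y \<longleftrightarrow> (\<bar>x\<bar> < 1 + s \<and> \<bar>y\<bar> < 1 + s)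
    \<or> (-1 - s < x \<and> x < 3 + s \<and> \<bar>y + 1\<bar> < s) \<or> (\<bar>x - 1\<bar> < s \<and> -1 - s < y \<and> y < 3 + s)
    \<or> (-3 - s < x \<and> x < 1 + s \<and> \<bar>y - 1\<bar> < s) \<or> (\<bar>x + 1\<bar> < s \<and> -3 - s < y \<and> y < 1 + s)"

definition hull_nbhd :: "real \<Rightarrow> (real^2^2) set" where
  "hull_nbhd s = {\<xi>. \<bar>\<xi> $ 1 $ 2\<bar> < s \<and> \<bar>\<xi> $ 2 $ 1\<bar> < s \<and> tartar_cross s (\<xi> $ 1 $ 1) (\<xi> $ 2 $ 2)}"

text \<open>Closed, so that the set of points still to be treated is open. The radius 2s exceeds the
  half-width s of the arms: a point of an arm that is not near its tip must be away from it in the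
  direction of the arm.\<close>

definition near_K :: "real \<Rightarrow> (real^2^2) set" where
  "near_K s = (\<Union>A\<in>K_set. {\<xi>. \<forall>i j. \<bar>\<xi> $ i $ j - A $ i $ j\<bar> \<le> 2 * s})"

definition diag_unit :: "2 \<Rightarrow> real^2^2" where
  "diag_unit j = axis j (axis j 1)"

lemma diag_unit_nth: "diag_unit l $ i $ j = (if i = l \<and> j = l then 1 else 0)"
  by (simp add: diag_unit_def axis_def)

section \<open>Segments inside the neighbourhood\<close>

lemma tartar_crossI:
  "\<bar>x\<bar> < 1 + s \<Longrightarrow> \<bar>y\<bar> < 1 + s \<Longrightarrow> tartar_cross s x y"
  "-1 - s < x \<Longrightarrow> x < 3 + s \<Longrightarrow> \<bar>y + 1\<bar> < s \<Longrightarrow> tartar_cross s x y"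
  "\<bar>x - 1\<bar> < s \<Longrightarrow> -1 - s < y \<Longrightarrow> y < 3 + s \<Longrightarrow> tartar_cross s x y"
  "-3 - s < x \<Longrightarrow> x < 1 + s \<Longrightarrow> \<bar>y - 1\<bar> < s \<Longrightarrow> tartar_cross s x y"
  "\<bar>x + 1\<bar> < s \<Longrightarrow> -3 - s < y \<Longrightarrow> y < 1 + s \<Longrightarrow> tartar_cross s x y"
  unfolding tartar_cross_def by blast+

text \<open>In the square a coordinate of modulus at most 1 can move by s/2. If both moduli exceed
  1, the point lies near a vertex, hence within an arm, and moves along that arm. A point outside
  the square also moves along its arm, where the exclusion of the tip leaves room.\<close>

lemma tartar_cross_segment:
  assumes s: "0 < s" "s \<le> 1/2" and W: "tartar_cross s x y"
    and "\<not> (\<bar>x - 3\<bar> \<le> 2 * s \<and> \<bar>y + 1\<bar> \<le> 2 * s)" "\<not> (\<bar>x - 1\<bar> \<le> 2 * s \<and> \<bar>y - 3\<bar> \<le> 2 * s)"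
    and "\<not> (\<bar>x + 3\<bar> \<le> 2 * s \<and> \<bar>y - 1\<bar> \<le> 2 * s)" "\<not> (\<bar>x + 1\<bar> \<le> 2 * s \<and> \<bar>y + 3\<bar> \<le> 2 * s)"
  shows "(\<forall>t. \<bar>t\<bar> \<le> s / 2 \<longrightarrow> tartar_cross s (x + t) y) \<or> (\<forall>t. \<bar>t\<bar> \<le> s / 2 \<longrightarrow> tartar_cross s x (y + t))"
proof (cases "\<bar>x\<bar> < 1 + s \<and> \<bar>y\<bar> < 1 + s")
  case True
  then consider "\<bar>x\<bar> \<le> 1" | "\<bar>y\<bar> \<le> 1" | "x > 1" "y > 1" | "x < -1" "y > 1" | "x < -1" "y < -1"
    | "x > 1" "y < -1" by linarith
  then show ?thesis
  proof cases
    case 1 then show ?thesis using s True by (intro disjI1 allI impI tartar_crossI(1)) auto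
  next
    case 2 then show ?thesis using s True by (intro disjI2 allI impI tartar_crossI(1)) auto
  next
    case 3 then show ?thesis using s True by (intro disjI2 allI impI tartar_crossI(3)) auto
  next
    case 4 then show ?thesis using s True by (intro disjI1 allI impI tartar_crossI(4)) auto
  next
    case 5 then show ?thesis using s True by (intro disjI2 allI impI tartar_crossI(5)) auto
  next
    case 6 then show ?thesis using s True by (intro disjI1 allI impI tartar_crossI(2)) auto
  qed
next
  case False
  with W consider "-1 - s < x" "x < 3 + s" "\<bar>y + 1\<bar> < s" | "\<bar>x - 1\<bar> < s" "-1 - s < y" "y < 3 + s"
    | "-3 - s < x" "x < 1 + s" "\<bar>y - 1\<bar> < s" | "\<bar>x + 1\<bar> < s" "-3 - s < y" "y < 1 + s"
    unfolding tartar_cross_def by blast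
  then show ?thesis
  proof cases
    case 1
    \<comment> \<open>Near its far end the arm lies in the square, which is excluded here. At the
      tip, |y + 1| < s already gives one of the two conditions for closeness, so the other one must
      fail.\<close>
    then have "-1 \<le> x" "x < 3 - 2 * s" using s False assms(4) by linarith+
    with 1 show ?thesis using s by (intro disjI1 allI impI tartar_crossI(2)) auto
  next
    case 2
    then have "-1 \<le> y" "y < 3 - 2 * s" using s False assms(5) by linarith+
    with 2 show ?thesis using s by (intro disjI2 allI impI tartar_crossI(3)) auto
  next
    case 3
    then have "x \<le> 1" "-3 + 2 * s < x" using s False assms(6) by linarith+
    with 3 show ?thesis using s by (intro disjI1 allI impI tartar_crossI(4)) auto
  next
    case 4
    then have "y \<le> 1" "-3 + 2 * s < y" using s False assms(7) by linarith+
    with 4 show ?thesis using s by (intro disjI2 allI impI tartar_crossI(5)) auto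
  qed
qed

lemma hull_nbhd_segment:
  assumes "0 < s" "s \<le> 1/2" "\<xi> \<in> hull_nbhd s" "\<xi> \<notin> near_K s"
  shows "\<exists>j. \<forall>t. \<bar>t\<bar> \<le> s / 2 \<longrightarrow> \<xi> + t *\<^sub>R diag_unit j \<in> hull_nbhd s"
proof -
  let ?x = "\<xi> $ 1 $ 1" and ?y = "\<xi> $ 2 $ 2"
  have o: "\<bar>\<xi> $ 1 $ 2\<bar> < s" "\<bar>\<xi> $ 2 $ 1\<bar> < s" "tartar_cross s ?x ?y"
    using assms(3) by (auto simp: hull_nbhd_def)
  \<comment> \<open>The off-diagonal entries are smaller than s, so the distance from
    \<open>A\<close> has to show on the diagonal.\<close>
  have n: "\<not> (\<bar>?x - A $ 1 $ 1\<bar> \<le> 2 * s \<and> \<bar>?y - A $ 2 $ 2\<bar> \<le> 2 * s)" if "A \<in> K_set" for A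
  proof -
    have "A $ 1 $ 2 = 0" "A $ 2 $ 1 = 0" using that by (auto simp: K_set_def A_entries)
    with assms(4) that o(1,2) assms(1) show ?thesis by (auto simp: near_K_def forall_2)
  qed
  have "(\<forall>t. \<bar>t\<bar> \<le> s / 2 \<longrightarrow> tartar_cross s (?x + t) ?y) \<or> (\<forall>t. \<bar>t\<bar> \<le> s / 2 \<longrightarrow> tartar_cross s ?x (?y + t))"
    using n[of A1] n[of A2] n[of A3] n[of A4]
    by (intro tartar_cross_segment assms o) (auto simp: K_set_def A_entries)
  then show ?thesis
  proof
    assume "\<forall>t. \<bar>t\<bar> \<le> s / 2 \<longrightarrow> tartar_cross s (?x + t) ?y"
    then show ?thesis using o by (intro exI[of _ 1]) (auto simp: hull_nbhd_def diag_unit_nth)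
  next
    assume "\<forall>t. \<bar>t\<bar> \<le> s / 2 \<longrightarrow> tartar_cross s ?x (?y + t)"
    then show ?thesis using o by (intro exI[of _ 2]) (auto simp: hull_nbhd_def diag_unit_nth)
  qed
qed

lemma open_hull_nbhd: "open (hull_nbhd s)"
  unfolding hull_nbhd_def tartar_cross_def
  by (intro open_Collect_conj open_Collect_disj open_Collect_less continuous_intros)

lemma closed_near_K: "closed (near_K s)"
  unfolding near_K_def
  by (intro closed_UN ballI closed_Collect_all closed_Collect_le continuous_intros) (simp add: K_set_def)

lemma rc_hull_subset_hull_nbhd:
  assumes "0 < s"
  shows "rc_hull K_set \<subseteq> hull_nbhd s"
proof
  fix \<eta> assume "\<eta> \<in> rc_hull K_set"
  note h = rc_hull_K_set[OF this]
  let ?x = "\<eta> $ 1 $ 1" and ?y = "\<eta> $ 2 $ 2"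
  consider "\<bar>?x\<bar> \<le> 1" "\<bar>?y\<bar> \<le> 1" | "?x > 1" | "?x < -1" | "?y > 1" | "?y < -1" by linarith
  then have "tartar_cross s ?x ?y"
  proof cases
    case 1 then show ?thesis using assms by (intro tartar_crossI(1)) auto
  next
    case 2
    then have "?y = -1" using h(5,8) by linarith
    with 2 show ?thesis using h(3) assms by (intro tartar_crossI(2)) auto
  next
    case 3
    then have "?y = 1" using h(6,7) by linarith
    with 3 show ?thesis using h(3) assms by (intro tartar_crossI(4)) auto
  next
    case 4
    then have "?x = 1" using h(5,6) by linarith
    with 4 show ?thesis using h(4) assms by (intro tartar_crossI(3)) auto
  next
    case 5
    then have "?x = -1" using h(7,8) by linarith
    with 5 show ?thesis using h(4) assms by (intro tartar_crossI(5)) auto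
  qed
  then show "\<eta> \<in> hull_nbhd s" using h(1,2) assms by (simp add: hull_nbhd_def)
qed

text \<open>The norm is dominated by the sum of the moduli of the four entries. This crude factor 4
  enters the constants 8, 12 and 16 below.\<close>

lemma norm_matrix_le:
  fixes \<xi> :: "real^2^2"
  assumes "\<And>i j. \<bar>\<xi> $ i $ j\<bar> \<le> c"
  shows "norm \<xi> \<le> 4 * c"
proof -
  have "norm \<xi> \<le> (\<Sum>i\<in>UNIV. norm (\<xi> $ i))" 
    unfolding norm_vec_def by (rule L2_set_le_sum) simp
  also have "\<dots> \<le> (\<Sum>i\<in>(UNIV::2 set). (\<Sum>j\<in>(UNIV::2 set). \<bar>\<xi> $ i $ j\<bar>))"
    by (intro sum_mono norm_le_l1_cart)
  also have "\<dots> \<le> (\<Sum>i\<in>(UNIV::2 set). (\<Sum>j\<in>(UNIV::2 set). c))"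
    by (intro sum_mono assms)
  finally show ?thesis by simp
qed

lemma infdist_near_K:
  assumes "\<xi> \<in> near_K s"
  shows "infdist \<xi> K_set \<le> 8 * s"
proof -
  obtain A where A: "A \<in> K_set" "\<And>i j. \<bar>(\<xi> - A) $ i $ j\<bar> \<le> 2 * s"
    using assms by (auto simp: near_K_def)
  have "infdist \<xi> K_set \<le> dist \<xi> A" using A(1) by (rule infdist_le)
  also have "\<dots> \<le> 4 * (2 * s)" unfolding dist_norm by (rule norm_matrix_le[OF A(2)])
  finally show ?thesis by simp
qed

text \<open>The arms end at 3 + s \<le> 4, so all entries are at most 4, and 16 is four times
  that.\<close>

lemma hull_nbhd_bounded:
  assumes "\<xi> \<in> hull_nbhd s" "0 < s" "s \<le> 1/2"
  shows "norm \<xi> \<le> 16"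
proof -
  have "\<bar>\<xi> $ i $ j\<bar> \<le> 4" for i j
  proof -
    have "tartar_cross s (\<xi> $ 1 $ 1) (\<xi> $ 2 $ 2)" "\<bar>\<xi> $ 1 $ 2\<bar> < s" "\<bar>\<xi> $ 2 $ 1\<bar> < s"
      using assms(1) by (auto simp: hull_nbhd_def)
    moreover from this(1) have "\<bar>\<xi> $ 1 $ 1\<bar> \<le> 4 \<and> \<bar>\<xi> $ 2 $ 2\<bar> \<le> 4"
      unfolding tartar_cross_def using assms(2,3) by (elim disjE conjE) auto
    ultimately show ?thesis using assms(2,3) exhaust_2[of i] exhaust_2[of j] by auto
  qed
  from norm_matrix_le[OF this] show ?thesis by simp
qed

section \<open>Potentials\<close>

definition kap :: "real \<Rightarrow> 2 \<Rightarrow> real" where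
  "kap k i = (if i = 1 then 1 else - k)"

text \<open>The fields \<open>(\<partial>\<^sub>1\<psi>, -k \<partial>\<^sub>2\<psi>)\<close> solve the linear constraint, whatever \<open>\<psi>\<close> is.\<close>

definition pot_field :: "real \<Rightarrow> (real^2 \<Rightarrow> real) \<Rightarrow> real^2 \<Rightarrow> real^2" where
  "pot_field k \<psi> x = (\<chi> i. kap k i * pd i \<psi> x)"

definition pot_grad :: "real \<Rightarrow> (real^2 \<Rightarrow> real) \<Rightarrow> real^2 \<Rightarrow> real^2^2" where
  "pot_grad k \<psi> x = (\<chi> i j. kap k i * pd j (pd i \<psi>) x)"

lemma smooth_cmult: "smooth f \<Longrightarrow> smooth (\<lambda>x. c * f x :: real)"
  by (intro smooth_mult smooth_const)

lemma pd_cmult: "f differentiable (at x) \<Longrightarrow> pd j (\<lambda>x. c * f x :: real) x = c * pd j f x"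
  by (rule pd_linear[OF bounded_linear_mult_right])

text \<open>The two entries seen by the constraint contribute k and -k times the mixed second
  derivatives of \<open>\<psi>\<close>, taken in opposite orders.\<close>

lemma L_form_pot_grad: "smooth \<psi> \<Longrightarrow> L_form k (pot_grad k \<psi> x) = 0"
  by (simp add: L_form_def L_mat_def sum_2 pot_grad_def kap_def pd_commute[of \<psi> 2 1])

lemma smooth_vec_lambda:
  fixes f :: "'m::finite \<Rightarrow> real^'n \<Rightarrow> real"
  assumes "\<And>i. smooth (f i)"
  shows "smooth (\<lambda>x. \<chi> i. f i x)"
proof -
  have "(\<lambda>x. \<chi> i. f i x) = (\<lambda>x. \<Sum>i\<in>UNIV. f i x *\<^sub>R axis i 1)"
    by (auto simp: vec_eq_iff axis_def if_distrib cong: if_cong)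
  moreover have "smooth (\<lambda>x. \<Sum>i\<in>UNIV. f i x *\<^sub>R axis i 1)"
    by (intro smooth_sum smooth_linear[OF bounded_linear_scaleR_left] assms)
  ultimately show ?thesis by simp
qed

lemma smooth_pot_field: "smooth \<psi> \<Longrightarrow> smooth (pot_field k \<psi>)"
  unfolding pot_field_def by (intro smooth_vec_lambda smooth_cmult smooth_pd)

lemma jacobian_nth:
  assumes "smooth f"
  shows "jacobian f (at x) $ i $ j = pd j (\<lambda>x. f x $ i) x"
  using pd_linear[OF bounded_linear_vec_nth smooth_differentiable[OF assms], of j i x]
  by (simp add: jacobian_def matrix_def pd_def)

lemma jacobian_pot_field: "smooth \<psi> \<Longrightarrow> jacobian (pot_field k \<psi>) (at x) = pot_grad k \<psi> x"
  by (simp add: vec_eq_iff jacobian_nth smooth_pot_field)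
     (simp add: pot_field_def pot_grad_def pd_cmult smooth_differentiable smooth_pd)

lemma continuous_pot_grad: "smooth \<psi> \<Longrightarrow> continuous_on S (pot_grad k \<psi>)"
  unfolding pot_grad_def by (intro continuous_on_vec_lambda smooth_continuous smooth_cmult smooth_pd)

lemma pd_smooth_add: "smooth f \<Longrightarrow> smooth g \<Longrightarrow> pd j (\<lambda>x. f x + g x) = (\<lambda>x. pd j f x + pd j g x)"
  by (intro ext pd_add smooth_differentiable)

lemma pot_grad_add:
  "smooth f \<Longrightarrow> smooth g \<Longrightarrow> pot_grad k (\<lambda>x. f x + g x) x = pot_grad k f x + pot_grad k g x"
  by (simp add: vec_eq_iff pot_grad_def pd_smooth_add smooth_pd algebra_simps)

lemma pd_support:
  assumes "compact K" "\<And>x. x \<notin> K \<Longrightarrow> f x = 0"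
  shows "x \<notin> K \<Longrightarrow> pd j f x = 0"
  using pd_zero_outside[OF compact_imp_closed[OF assms(1)] assms(2)] .

lemma pot_grad_support:
  assumes "compact K" "\<And>x. x \<notin> K \<Longrightarrow> f x = 0" "x \<notin> K"
  shows "pot_grad k f x = 0"
  using pd_support[OF assms(1) pd_support[OF assms(1,2)]] assms(3)
  by (simp add: vec_eq_iff pot_grad_def)

section \<open>Oscillations\<close>

lemma smooth_cos_sin:
  fixes g :: "real^'n \<Rightarrow> real"
  assumes "smooth g"
  shows "smooth (\<lambda>x. cos (g x))" "smooth (\<lambda>x. sin (g x))"
proof -
  have *: "\<exists>h1\<in>{sin, cos}. \<exists>h2\<in>{sin, cos}. \<exists>a b. \<forall>t. (h has_real_derivative a * h1 t + b * h2 t) (at t)"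
    if "h \<in> {sin, cos}" for h :: "real \<Rightarrow> real"
  proof -
    from that consider "h = sin" | "h = cos" by auto
    then show ?thesis
    proof cases
      case 1
      have "\<forall>t. (sin has_real_derivative 1 * cos t + 0 * cos t) (at t)" by (auto intro!: derivative_eq_intros)
      with 1 show ?thesis by blast
    next
      case 2
      have "\<forall>t. (cos has_real_derivative (-1) * sin t + 0 * cos t) (at t)" by (auto intro!: derivative_eq_intros)
      with 2 show ?thesis by blast
    qed
  qed
  show "smooth (\<lambda>x. cos (g x))"
    by (rule smooth_compose[of "{sin, cos}" g cos]) (use * assms in blast)+
  show "smooth (\<lambda>x. sin (g x))"
    by (rule smooth_compose[of "{sin, cos}" g sin]) (use * assms in blast)+
qed

lemma pd_cos_sin:
  fixes g :: "real^'n \<Rightarrow> real"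
  assumes "smooth g"
  shows "pd j (\<lambda>x. cos (g x)) x = - sin (g x) * pd j g x" "pd j (\<lambda>x. sin (g x)) x = cos (g x) * pd j g x"
  by (rule pd_chain[OF DERIV_cos smooth_differentiable[OF assms]],
      rule pd_chain[OF DERIV_sin smooth_differentiable[OF assms]])

text \<open>With the factor \<open>\<tau>\<^sup>2\<close> two derivatives of the cosine are of order
  one and a single one is of order \<open>\<tau>\<close>. The phase \<open>p\<close> stays free
  until \<open>oscillation_phase\<close> selects it.\<close>

definition osc :: "2 \<Rightarrow> real \<Rightarrow> real \<Rightarrow> real \<Rightarrow> (real^2 \<Rightarrow> real) \<Rightarrow> real^2 \<Rightarrow> real" where
  "osc j a p \<tau> \<theta> x = (a * \<tau>\<^sup>2) * (\<theta> x * cos (x $ j / \<tau> + p))"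

definition phase :: "2 \<Rightarrow> real \<Rightarrow> real \<Rightarrow> real^2 \<Rightarrow> real" where
  "phase j p \<tau> x = (1 / \<tau>) * x $ j + p"

lemma osc_eq: "osc j a p \<tau> \<theta> = (\<lambda>x. (a * \<tau>\<^sup>2) * (\<theta> x * cos (phase j p \<tau> x)))"
  by (simp add: osc_def phase_def fun_eq_iff)

lemma smooth_phase: "smooth (phase j p \<tau>)"
  unfolding phase_def by (intro smooth_add smooth_cmult smooth_nth smooth_const)

lemma pd_const: "pd j (\<lambda>x. c) x = 0"
  by (rule pd_eqI[OF has_derivative_const])

lemma pd_phase: "pd j (phase l p \<tau>) x = (if l = j then 1 / \<tau> else 0)"
  unfolding phase_def
  by (simp add: pd_smooth_add smooth_cmult smooth_nth smooth_const pd_cmult smooth_differentiable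
      pd_nth pd_const del: times_divide_eq_left)

lemma smooth_osc: "smooth \<theta> \<Longrightarrow> smooth (osc j a p \<tau> \<theta>)"
  unfolding osc_eq by (intro smooth_cmult smooth_mult smooth_cos_sin smooth_phase)

lemma pd_osc:
  assumes "smooth \<theta>" "\<tau> \<noteq> 0"
  shows "pd i (osc j a p \<tau> \<theta>) = (\<lambda>x. (a * \<tau>\<^sup>2) * (pd i \<theta> x * cos (phase j p \<tau> x))
      + (- a * \<tau> * (if j = i then 1 else 0)) * (\<theta> x * sin (phase j p \<tau> x)))"
proof
  fix x
  have "pd i (osc j a p \<tau> \<theta>) x = (a * \<tau>\<^sup>2) * pd i (\<lambda>x. \<theta> x * cos (phase j p \<tau> x)) x"
    unfolding osc_eq
    by (intro pd_cmult smooth_differentiable smooth_mult smooth_cos_sin smooth_phase assms)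
  also have "pd i (\<lambda>x. \<theta> x * cos (phase j p \<tau> x)) x
      = \<theta> x * pd i (\<lambda>x. cos (phase j p \<tau> x)) x + pd i \<theta> x * cos (phase j p \<tau> x)"
    by (intro pd_mult smooth_differentiable smooth_cos_sin smooth_phase assms)
  finally show "pd i (osc j a p \<tau> \<theta>) x = (a * \<tau>\<^sup>2) * (pd i \<theta> x * cos (phase j p \<tau> x))
      + (- a * \<tau> * (if j = i then 1 else 0)) * (\<theta> x * sin (phase j p \<tau> x))"
    using assms(2) by (cases "j = i") (simp_all add: pd_cos_sin smooth_phase pd_phase algebra_simps power2_eq_square)
qed

text \<open>The terms are arranged by powers of \<open>\<tau>\<close>: second, first, zeroth. Only
  the last survives for small \<open>\<tau>\<close>, and it sits in the single diagonal entry with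
  index j.\<close>

lemma pd_pd_osc:
  assumes "smooth \<theta>" "\<tau> \<noteq> 0"
  shows "pd l (pd i (osc j a p \<tau> \<theta>)) x = (a * \<tau>\<^sup>2) * (pd l (pd i \<theta>) x * cos (phase j p \<tau> x))
      - a * \<tau> * ((if j = l then 1 else 0) * pd i \<theta> x + (if j = i then 1 else 0) * pd l \<theta> x) * sin (phase j p \<tau> x)
      - (if i = j \<and> l = j then a * (\<theta> x * cos (phase j p \<tau> x)) else 0)"
proof -
  let ?d = "- a * \<tau> * (if j = i then 1 else 0)"
  note sm = smooth_mult smooth_cos_sin smooth_phase smooth_pd assms(1)
  have "pd l (pd i (osc j a p \<tau> \<theta>)) x
      = (a * \<tau>\<^sup>2) * pd l (\<lambda>x. pd i \<theta> x * cos (phase j p \<tau> x)) x + ?d * pd l (\<lambda>x. \<theta> x * sin (phase j p \<tau> x)) x"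
    unfolding pd_osc[OF assms]
    by (subst pd_add pd_cmult; (intro smooth_differentiable smooth_cmult sm)?)+ (rule refl)
  also have "pd l (\<lambda>x. pd i \<theta> x * cos (phase j p \<tau> x)) x
      = pd i \<theta> x * pd l (\<lambda>x. cos (phase j p \<tau> x)) x + pd l (pd i \<theta>) x * cos (phase j p \<tau> x)"
    by (intro pd_mult smooth_differentiable sm)
  also have "pd l (\<lambda>x. \<theta> x * sin (phase j p \<tau> x)) x
      = \<theta> x * pd l (\<lambda>x. sin (phase j p \<tau> x)) x + pd l \<theta> x * sin (phase j p \<tau> x)"
    by (intro pd_mult smooth_differentiable sm)
  finally show ?thesis
    using assms(2) by (cases "j = i"; cases "j = l")
      (simp_all add: pd_cos_sin smooth_phase pd_phase algebra_simps power2_eq_square)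
qed

text \<open>Adding the leading term back cancels it in \<open>pd_pd_osc\<close>. Three terms remain,
  each at most M |a| \<open>\<tau>\<close> since \<open>\<tau>\<^sup>2 \<le> \<tau>\<close>; the
  first derivative has two such terms.\<close>

lemma osc_bounds:
  assumes \<theta>: "smooth \<theta>" and \<tau>: "0 < \<tau>" "\<tau> \<le> 1"
    and M: "\<And>x. \<bar>\<theta> x\<bar> \<le> M" "\<And>i x. \<bar>pd i \<theta> x\<bar> \<le> M" "\<And>i l x. \<bar>pd l (pd i \<theta>) x\<bar> \<le> M"
  shows "\<bar>pd i (osc j a p \<tau> \<theta>) x\<bar> \<le> 2 * M * \<bar>a\<bar> * \<tau>"
    and "\<bar>pd l (pd i (osc j a p \<tau> \<theta>)) x + (if i = j \<and> l = j then a * (\<theta> x * cos (phase j p \<tau> x)) else 0)\<bar>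
      \<le> 3 * M * \<bar>a\<bar> * \<tau>"
proof -
  let ?c = "cos (phase j p \<tau> x)" and ?s = "sin (phase j p \<tau> x)"
  have M0: "0 \<le> M" using M(1)[of 0] by linarith
  have prod: "\<bar>u * v\<bar> \<le> M" if "\<bar>u\<bar> \<le> M" "\<bar>v\<bar> \<le> 1" for u v :: real
    using mult_mono[OF that] M0 by (simp add: abs_mult)
  have t2: "\<tau>\<^sup>2 \<le> \<tau>" using \<tau> by (simp add: power2_eq_square mult_left_le_one_le)
  have first: "\<bar>(a * \<tau>\<^sup>2) * u\<bar> \<le> M * \<bar>a\<bar> * \<tau>" if "\<bar>u\<bar> \<le> M" for u
  proof -
    have "\<bar>(a * \<tau>\<^sup>2) * u\<bar> = (\<bar>a\<bar> * \<tau>\<^sup>2) * \<bar>u\<bar>" by (simp add: abs_mult)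
    also have "\<dots> \<le> (\<bar>a\<bar> * \<tau>) * M" using that t2 \<tau> by (intro mult_mono) auto
    finally show ?thesis by (simp add: ac_simps)
  qed
  have second: "\<bar>a * \<tau> * u\<bar> \<le> M * \<bar>a\<bar> * \<tau>" if "\<bar>u\<bar> \<le> M" for u
  proof -
    have "\<bar>a * \<tau> * u\<bar> = (\<bar>a\<bar> * \<tau>) * \<bar>u\<bar>" using \<tau> by (simp add: abs_mult)
    also have "\<dots> \<le> (\<bar>a\<bar> * \<tau>) * M" using that \<tau> by (intro mult_left_mono) auto
    finally show ?thesis by (simp add: ac_simps)
  qed
  have "pd i (osc j a p \<tau> \<theta>) x = (a * \<tau>\<^sup>2) * (pd i \<theta> x * ?c) - a * \<tau> * ((if j = i then \<theta> x else 0) * ?s)"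
    using \<tau> by (simp add: pd_osc[OF \<theta>])
  moreover have "\<bar>(a * \<tau>\<^sup>2) * (pd i \<theta> x * ?c)\<bar> \<le> M * \<bar>a\<bar> * \<tau>"
    by (intro first prod M) simp
  moreover have "\<bar>a * \<tau> * ((if j = i then \<theta> x else 0) * ?s)\<bar> \<le> M * \<bar>a\<bar> * \<tau>"
    by (intro second prod) (use M M0 in auto)
  ultimately show "\<bar>pd i (osc j a p \<tau> \<theta>) x\<bar> \<le> 2 * M * \<bar>a\<bar> * \<tau>" by linarith
  have "pd l (pd i (osc j a p \<tau> \<theta>)) x + (if i = j \<and> l = j then a * (\<theta> x * ?c) else 0)
      = (a * \<tau>\<^sup>2) * (pd l (pd i \<theta>) x * ?c) - a * \<tau> * ((if j = l then pd i \<theta> x else 0) * ?s)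
        - a * \<tau> * ((if j = i then pd l \<theta> x else 0) * ?s)"
    using \<tau> by (simp add: pd_pd_osc[OF \<theta>] algebra_simps)
  moreover have "\<bar>(a * \<tau>\<^sup>2) * (pd l (pd i \<theta>) x * ?c)\<bar> \<le> M * \<bar>a\<bar> * \<tau>"
    by (intro first prod M) simp
  moreover have "\<bar>a * \<tau> * ((if j = l then pd i \<theta> x else 0) * ?s)\<bar> \<le> M * \<bar>a\<bar> * \<tau>"
    "\<bar>a * \<tau> * ((if j = i then pd l \<theta> x else 0) * ?s)\<bar> \<le> M * \<bar>a\<bar> * \<tau>"
    by (intro second prod; use M M0 in auto)+
  ultimately show "\<bar>pd l (pd i (osc j a p \<tau> \<theta>)) x + (if i = j \<and> l = j then a * (\<theta> x * ?c) else 0)\<bar>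
      \<le> 3 * M * \<bar>a\<bar> * \<tau>" by linarith
qed

section \<open>Energy gain by one oscillation\<close>

text \<open>The constant matrix \<open>\<eta>\<close> is left out, so that for compactly supported
  potentials the integrand has compact support and the whole plane can serve as domain of
  integration.\<close>

definition energy :: "real \<Rightarrow> (real^2 \<Rightarrow> real) \<Rightarrow> real" where
  "energy k \<psi> = (\<integral>x. (norm (pot_grad k \<psi> x))\<^sup>2 \<partial>lborel)"

lemma abs_kap_le: "\<bar>kap k i\<bar> \<le> 1 + \<bar>k\<bar>"
  by (simp add: kap_def)

text \<open>The plus sign compensates the minus sign in the second derivative of the cosine. The
  factor 12 is four entries times the three error terms of \<open>osc_bounds\<close>.\<close>

lemma osc_pot_grad:
  assumes \<theta>: "smooth \<theta>" and \<tau>: "0 < \<tau>" "\<tau> \<le> 1"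
    and M: "\<And>x. \<bar>\<theta> x\<bar> \<le> M" "\<And>i x. \<bar>pd i \<theta> x\<bar> \<le> M" "\<And>i l x. \<bar>pd l (pd i \<theta>) x\<bar> \<le> M"
  shows "norm (pot_grad k (osc j a p \<tau> \<theta>) x
      + (kap k j * a * (\<theta> x * cos (phase j p \<tau> x))) *\<^sub>R diag_unit j) \<le> 12 * (1 + \<bar>k\<bar>) * M * \<bar>a\<bar> * \<tau>"
    (is "norm ?D \<le> _")
proof -
  have "norm ?D \<le> 4 * ((1 + \<bar>k\<bar>) * (3 * M * \<bar>a\<bar> * \<tau>))"
  proof (rule norm_matrix_le)
    fix i l
    let ?d = "pd l (pd i (osc j a p \<tau> \<theta>)) x
      + (if i = j \<and> l = j then a * (\<theta> x * cos (phase j p \<tau> x)) else 0)"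
    have "?D $ i $ l = kap k i * ?d"
      by (auto simp: pot_grad_def diag_unit_nth algebra_simps)
    then have "\<bar>?D $ i $ l\<bar> = \<bar>kap k i\<bar> * \<bar>?d\<bar>" by (simp add: abs_mult)
    also have "\<dots> \<le> (1 + \<bar>k\<bar>) * (3 * M * \<bar>a\<bar> * \<tau>)"
      by (intro mult_mono abs_kap_le osc_bounds[OF \<theta> \<tau> M]) auto
    finally show "\<bar>?D $ i $ l\<bar> \<le> (1 + \<bar>k\<bar>) * (3 * M * \<bar>a\<bar> * \<tau>)" .
  qed
  then show ?thesis by (simp add: algebra_simps)
qed

section \<open>The mixed term of the energy\<close>

lemma integral_le_indicator_compact:
  assumes "compact K" "integrable lborel f" "\<And>x. f x \<le> c * indicator K x"
  shows "(\<integral>x. f x \<partial>lborel) \<le> c * measure lborel (K :: 'a::euclidean_space set)"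
proof -
  have i: "integrable lborel (\<lambda>x. indicator K x :: real)"
    using emeasure_compact_finite[OF assms(1)] compact_imp_closed[OF assms(1)]
    by (intro integrable_real_indicator) auto
  have "(\<integral>x. f x \<partial>lborel) \<le> (\<integral>x. c * indicator K x \<partial>lborel)"
    by (rule integral_mono[OF assms(2)]) (use i assms(3) in auto)
  then show ?thesis by simp
qed

text \<open>In the application only \<open>g\<close> is small while its derivative is not, so
  integration by parts moves the derivative to \<open>f\<close>.\<close>

lemma cross_term_bound:
  fixes f g :: "real^'n \<Rightarrow> real"
  assumes "smooth f" "smooth g" and K: "compact K" "\<And>x. x \<notin> K \<Longrightarrow> g x = 0"
    and b: "\<And>x. \<bar>g x\<bar> \<le> b" and B: "\<And>x. \<bar>pd l f x\<bar> \<le> B"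
  shows "\<bar>\<integral>x. f x * pd l g x \<partial>lborel\<bar> \<le> B * b * measure lborel K"
proof -
  have i: "integrable lborel (\<lambda>x. pd l f x * g x)"
    using K by (intro integrable_compact_support[of _ K] smooth_continuous smooth_mult smooth_pd assms) auto
  have "\<bar>\<integral>x. f x * pd l g x \<partial>lborel\<bar> = \<bar>\<integral>x. pd l f x * g x \<partial>lborel\<bar>"
    by (simp add: integration_by_parts[OF assms(1,2) K])
  also have "\<dots> \<le> (\<integral>x. \<bar>pd l f x * g x\<bar> \<partial>lborel)"
    using integral_abs_bound[of lborel "\<lambda>x. pd l f x * g x"] by simp
  also have "\<dots> \<le> (B * b) * measure lborel K"
  proof (rule integral_le_indicator_compact[OF K(1)])
    show "integrable lborel (\<lambda>x. \<bar>pd l f x * g x\<bar>)" using i by simp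
    fix x
    have "\<bar>pd l f x\<bar> * \<bar>g x\<bar> \<le> B * b"
      by (intro mult_mono b B order_trans[OF abs_ge_zero B]) simp
    then show "\<bar>pd l f x * g x\<bar> \<le> B * b * indicator K x"
      using K(2)[of x] by (auto simp: indicator_def abs_mult)
  qed
  finally show ?thesis .
qed

text \<open>\<open>cross_term_bound\<close> with the first derivatives of \<open>\<omega>\<close> as
  the small functions, once for each of the four entries. The constant \<open>B\<close> concerns
  third derivatives of \<open>\<psi>\<close>, which are known before the wavelength of
  \<open>\<omega>\<close> is chosen.\<close>

lemma pot_grad_inner_bound:
  assumes \<psi>: "smooth \<psi>" and \<omega>: "smooth \<omega>" and K: "compact K" "\<And>x. x \<notin> K \<Longrightarrow> \<omega> x = 0"
    and b: "\<And>i x. \<bar>pd i \<omega> x\<bar> \<le> b" and B: "\<And>i l x. \<bar>pd l (\<lambda>x. (kap k i)\<^sup>2 * pd l (pd i \<psi>) x) x\<bar> \<le> B"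
  shows "\<bar>\<integral>x. pot_grad k \<psi> x \<bullet> pot_grad k \<omega> x \<partial>lborel\<bar> \<le> 4 * (B * b * measure lborel K)"
proof -
  let ?f = "\<lambda>i l x. (kap k i)\<^sup>2 * pd l (pd i \<psi>) x"
  have s0: "x \<notin> K \<Longrightarrow> pd i \<omega> x = 0" for i x by (rule pd_support[OF K])
  have s1: "x \<notin> K \<Longrightarrow> pd l (pd i \<omega>) x = 0" for i l x
    using pd_support[OF K(1) s0] .
  have "pot_grad k \<psi> x \<bullet> pot_grad k \<omega> x = (\<Sum>i\<in>UNIV. \<Sum>l\<in>UNIV. ?f i l x * pd l (pd i \<omega>) x)" for x
    by (simp add: pot_grad_def inner_vec_def power2_eq_square ac_simps)
  moreover have "integrable lborel (\<lambda>x. ?f i l x * pd l (pd i \<omega>) x)" for i l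
    using s1 by (intro integrable_compact_support[of _ K] smooth_continuous smooth_cmult smooth_mult smooth_pd \<psi> \<omega> K(1)) auto
  ultimately have "(\<integral>x. pot_grad k \<psi> x \<bullet> pot_grad k \<omega> x \<partial>lborel)
      = (\<Sum>i\<in>UNIV. \<Sum>l\<in>UNIV. \<integral>x. ?f i l x * pd l (pd i \<omega>) x \<partial>lborel)"
    by simp
  also have "\<bar>\<dots>\<bar> \<le> (\<Sum>i\<in>(UNIV::2 set). \<Sum>l\<in>(UNIV::2 set). B * b * measure lborel K)"
    by (intro order_trans[OF sum_abs] sum_mono cross_term_bound smooth_cmult smooth_pd \<psi> \<omega> K(1) s0 b B)
  finally show ?thesis by simp
qed

lemma integrable_pot_grad_inner:
  assumes "smooth \<psi>" "smooth \<omega>" "compact K" "\<And>x. x \<notin> K \<Longrightarrow> \<omega> x = 0"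
  shows "integrable lborel (\<lambda>x. pot_grad k \<psi> x \<bullet> pot_grad k \<omega> x)"
  using pot_grad_support[OF assms(3,4)]
  by (intro integrable_compact_support[of _ K] continuous_intros continuous_pot_grad assms) auto

lemma energy_add:
  assumes \<psi>: "smooth \<psi>" "compact K'" "\<And>x. x \<notin> K' \<Longrightarrow> \<psi> x = 0"
    and \<omega>: "smooth \<omega>" "compact K" "\<And>x. x \<notin> K \<Longrightarrow> \<omega> x = 0"
  shows "energy k (\<lambda>x. \<psi> x + \<omega> x)
    = energy k \<psi> + 2 * (\<integral>x. pot_grad k \<psi> x \<bullet> pot_grad k \<omega> x \<partial>lborel) + energy k \<omega>"
proof -
  note i = integrable_pot_grad_inner[OF \<psi>(1) \<psi>, of k] integrable_pot_grad_inner[OF \<psi>(1) \<omega>, of k]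
    integrable_pot_grad_inner[OF \<omega>(1) \<omega>, of k]
  have "energy k (\<lambda>x. \<psi> x + \<omega> x) = (\<integral>x. (pot_grad k \<psi> x \<bullet> pot_grad k \<psi> x
      + 2 * (pot_grad k \<psi> x \<bullet> pot_grad k \<omega> x)) + pot_grad k \<omega> x \<bullet> pot_grad k \<omega> x \<partial>lborel)"
    unfolding energy_def pot_grad_add[OF \<psi>(1) \<omega>(1)] power2_norm_eq_inner
    by (intro Bochner_Integration.integral_cong refl) (simp add: inner_add inner_commute)
  also have "\<dots> = energy k \<psi> + 2 * (\<integral>x. pot_grad k \<psi> x \<bullet> pot_grad k \<omega> x \<partial>lborel) + energy k \<omega>"
    using i by (simp add: energy_def power2_norm_eq_inner)
  finally show ?thesis .
qed

text \<open>Inner regularity of Lebesgue measure, with half of the measure as tolerance.\<close>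

lemma compact_inner_half:
  fixes U :: "(real^'n) set"
  assumes "open U" "bounded U" "measure lborel U > 0"
  obtains T where "compact T" "T \<subseteq> U" "measure lborel U / 2 \<le> measure lborel T"
proof -
  have "U \<in> sets lebesgue" "0 < measure lborel U / 2" using assms by auto
  then obtain T where T: "closed T" "T \<subseteq> U" "U - T \<in> lmeasurable"
    and less: "emeasure lebesgue (U - T) < ennreal (measure lborel U / 2)"
    by (rule sets_lebesgue_inner_closed)
  have cT: "compact T" using T assms by (meson bounded_subset compact_eq_bounded_closed)
  have fin: "emeasure lborel U < \<infinity>" using emeasure_bounded_finite[OF assms(2)] .
  have s: "U \<in> sets lborel" "T \<in> sets lborel" using assms T by auto
  have "emeasure lborel (U - T) < ennreal (measure lborel U / 2)"
    using less s by (simp add: emeasure_completion)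
  then have "measure lborel (U - T) < measure lborel U / 2"
    using emeasure_eq_ennreal_measure[of lborel "U - T"] ennreal_less_iff[OF measure_nonneg]
    by (metis less_top_ennreal order_less_trans top.not_eq_extremum)
  moreover have "measure lborel (U - T) = measure lborel U - measure lborel T"
    using s T(2) fin by (intro measure_Diff) auto
  ultimately show thesis using that[OF cT T(2)] by linarith
qed

text \<open>The phases 0 and -pi/2 give the cosine and the sine, whose squares sum to 1, so one of
  the two keeps at least half of the integral. This replaces the weak limit 1/2 of rapidly
  oscillating squares and works for each \<open>\<tau>\<close> separately.\<close>

lemma oscillation_phase:
  assumes "smooth \<theta>" "compact K" "\<And>x. x \<notin> K \<Longrightarrow> \<theta> x = 0"
  obtains p where "(\<integral>x. (\<theta> x)\<^sup>2 \<partial>lborel) / 2 \<le> (\<integral>x. (\<theta> x * cos (phase j p \<tau> x))\<^sup>2 \<partial>lborel)"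
proof -
  let ?I = "\<lambda>p. \<integral>x. (\<theta> x * cos (phase j p \<tau> x))\<^sup>2 \<partial>lborel"
  have i: "integrable lborel (\<lambda>x. (\<theta> x * cos (phase j p \<tau> x))\<^sup>2)" for p
    using assms(3)
    by (intro integrable_compact_support[of _ K] continuous_intros smooth_continuous smooth_phase assms) auto
  have "cos (phase j (- pi / 2) \<tau> x) = sin (phase j 0 \<tau> x)" for x
    using cos_diff[of "phase j 0 \<tau> x" "pi / 2"] by (simp add: phase_def)
  then have "(\<theta> x * cos (phase j 0 \<tau> x))\<^sup>2 + (\<theta> x * cos (phase j (- pi / 2) \<tau> x))\<^sup>2 = (\<theta> x)\<^sup>2" for x
    by (simp add: power_mult_distrib distrib_left[symmetric])
  then have "?I 0 + ?I (- pi / 2) = (\<integral>x. (\<theta> x)\<^sup>2 \<partial>lborel)"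
    by (subst Bochner_Integration.integral_add[OF i i, symmetric]) simp
  then have "(\<integral>x. (\<theta> x)\<^sup>2 \<partial>lborel) / 2 \<le> ?I 0 \<or> (\<integral>x. (\<theta> x)\<^sup>2 \<partial>lborel) / 2 \<le> ?I (- pi / 2)"
    by linarith
  then show thesis using that by blast
qed

text \<open>The denominator Q + 1 covers the case Q = 0 as well and makes the inequality
  strict.\<close>

lemma scaled_less:
  fixes Q e \<tau> :: real
  assumes "0 \<le> Q" "0 < e" "0 < \<tau>" "\<tau> \<le> e / (Q + 1)"
  shows "Q * \<tau> < e"
proof -
  have "(Q + 1) * \<tau> \<le> e" using assms by (simp add: field_simps)
  then show ?thesis using assms by (simp add: algebra_simps)
qed

lemma small_scale:
  fixes Q1 Q2 Q3 e1 e2 e3 :: real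
  assumes "0 \<le> Q1" "0 \<le> Q2" "0 \<le> Q3" "0 < e1" "0 < e2" "0 < e3"
  obtains \<tau> where "0 < \<tau>" "\<tau> \<le> 1" "Q1 * \<tau> < e1" "Q2 * \<tau> < e2" "Q3 * \<tau> < e3"
proof
  let ?t = "min 1 (min (e1 / (Q1 + 1)) (min (e2 / (Q2 + 1)) (e3 / (Q3 + 1))))"
  show t: "0 < ?t" using assms by auto
  show "?t \<le> 1" by auto
  show "Q1 * ?t < e1" "Q2 * ?t < e2" "Q3 * ?t < e3"
    by (rule scaled_less; use assms t in auto)+
qed

text \<open>Third derivatives are included because the estimate of the mixed term differentiates the
  second derivatives of \<open>\<psi>\<close> once more.\<close>

lemma smooth_bounds:
  assumes "smooth \<theta>" "compact K" "\<And>x. x \<notin> K \<Longrightarrow> \<theta> x = 0"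
  obtains M where "0 \<le> M" "\<And>x. \<bar>\<theta> x :: real\<bar> \<le> M" "\<And>i x. \<bar>pd i \<theta> x\<bar> \<le> M"
    "\<And>i l x. \<bar>pd l (pd i \<theta>) x\<bar> \<le> M" "\<And>i l m x. \<bar>pd m (pd l (pd i \<theta>)) x\<bar> \<le> M"
proof -
  note s1 = pd_support[OF assms(2,3)]
  note s2 = pd_support[OF assms(2) s1]
  note s3 = pd_support[OF assms(2) s2]
  let ?F = "\<lambda>x. \<bar>\<theta> x\<bar> + (\<Sum>i\<in>UNIV. \<bar>pd i \<theta> x\<bar>) + (\<Sum>i\<in>UNIV. \<Sum>l\<in>UNIV. \<bar>pd l (pd i \<theta>) x\<bar>)
    + (\<Sum>i\<in>UNIV. \<Sum>l\<in>UNIV. \<Sum>m\<in>UNIV. \<bar>pd m (pd l (pd i \<theta>)) x\<bar>)"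
  have c: "continuous_on K ?F"
    by (intro continuous_intros smooth_continuous smooth_pd assms(1))
  obtain M where M: "M > 0" "\<And>x. norm (?F x) \<le> M"
    by (rule bounded_compact_support[OF c assms(2)]) (use assms(3) s1 s2 s3 in auto)
  have n: "0 \<le> (\<Sum>i\<in>UNIV. \<bar>pd i \<theta> x\<bar>)" "0 \<le> (\<Sum>i\<in>UNIV. \<Sum>l\<in>UNIV. \<bar>pd l (pd i \<theta>) x\<bar>)"
    "0 \<le> (\<Sum>i\<in>UNIV. \<Sum>l\<in>UNIV. \<Sum>m\<in>UNIV. \<bar>pd m (pd l (pd i \<theta>)) x\<bar>)" for x
    by (intro sum_nonneg abs_ge_zero)+
  have l1: "\<bar>pd i \<theta> x\<bar> \<le> (\<Sum>i\<in>UNIV. \<bar>pd i \<theta> x\<bar>)" for i x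
    by (rule member_le_sum) auto
  have l2: "\<bar>pd l (pd i \<theta>) x\<bar> \<le> (\<Sum>i\<in>UNIV. \<Sum>l\<in>UNIV. \<bar>pd l (pd i \<theta>) x\<bar>)" for i l x
    by (rule order_trans[OF member_le_sum[of l UNIV "\<lambda>l. \<bar>pd l (pd i \<theta>) x\<bar>"]
          member_le_sum[of i UNIV "\<lambda>i. \<Sum>l\<in>UNIV. \<bar>pd l (pd i \<theta>) x\<bar>"]]) (auto intro: sum_nonneg)
  have l3: "\<bar>pd m (pd l (pd i \<theta>)) x\<bar> \<le> (\<Sum>i\<in>UNIV. \<Sum>l\<in>UNIV. \<Sum>m\<in>UNIV. \<bar>pd m (pd l (pd i \<theta>)) x\<bar>)" for i l m x
    by (rule order_trans[OF order_trans[OF member_le_sum[of m UNIV "\<lambda>m. \<bar>pd m (pd l (pd i \<theta>)) x\<bar>"]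
          member_le_sum[of l UNIV "\<lambda>l. \<Sum>m\<in>UNIV. \<bar>pd m (pd l (pd i \<theta>)) x\<bar>"]]
          member_le_sum[of i UNIV "\<lambda>i. \<Sum>l\<in>UNIV. \<Sum>m\<in>UNIV. \<bar>pd m (pd l (pd i \<theta>)) x\<bar>"]]) (auto intro: sum_nonneg)
  have F: "?F x \<le> M" for x using M(2)[of x] by (simp only: real_norm_def abs_le_iff)
  show thesis
  proof (rule that[of M])
    show "0 \<le> M" using M by simp
    show "\<bar>\<theta> x\<bar> \<le> M" for x using F[of x] n[of x] by linarith
    show "\<bar>pd i \<theta> x\<bar> \<le> M" for i x using F[of x] n[of x] l1[of i x] by linarith
    show "\<bar>pd l (pd i \<theta>) x\<bar> \<le> M" for i l x using F[of x] n[of x] l2[of l i x] by linarith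
    show "\<bar>pd m (pd l (pd i \<theta>)) x\<bar> \<le> M" for i l m x using F[of x] n[of x] l3[of m l i x] by linarith
  qed
qed

text \<open>The constant 1/64 collects the losses. The cutoff is at least 1/2 on a set of half the
  measure m of \<open>U\<close>, so its square integrates to at least m/8; the choice of the phase
  leaves m/16; (u + v)^2 \<le> 2 u^2 + 2 v^2 turns this into r^2 m/32; half of that pays for the
  errors.\<close>

lemma oscillation_step:
  assumes \<psi>: "smooth \<psi>" "compact K'" "\<And>x. x \<notin> K' \<Longrightarrow> \<psi> x = 0"
    and V: "open V" "\<And>x. \<eta> + pot_grad k \<psi> x \<in> V"
    and U: "open U" "bounded U"
    and seg: "\<And>x t. x \<in> U \<Longrightarrow> \<bar>t\<bar> \<le> r \<Longrightarrow> \<eta> + pot_grad k \<psi> x + t *\<^sub>R diag_unit j \<in> V"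
    and k: "k \<noteq> 0" and r: "r > 0" and \<delta>: "\<delta> > 0"
  obtains \<omega> K where "smooth \<omega>" "compact K" "K \<subseteq> U" "\<And>x. x \<notin> K \<Longrightarrow> \<omega> x = 0"
    "\<And>x. \<eta> + pot_grad k (\<lambda>x. \<psi> x + \<omega> x) x \<in> V" "\<And>i x. \<bar>pd i \<omega> x\<bar> \<le> \<delta>"
    "energy k \<psi> + r\<^sup>2 / 64 * measure lborel U \<le> energy k (\<lambda>x. \<psi> x + \<omega> x)"
proof (cases "measure lborel U = 0")
  case True
  show thesis
    by (rule that[of "\<lambda>x. 0" "{}"]) (use True V(2) \<delta> in \<open>auto simp: smooth_const pd_const\<close>)
next
  case False
  define m where "m = measure lborel U"
  have m: "m > 0" using False by (simp add: m_def zero_less_measure_iff)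
  obtain T where T: "compact T" "T \<subseteq> U" "m / 2 \<le> measure lborel T"
    using compact_inner_half[OF U] m unfolding m_def by blast
  obtain \<theta> :: "real^2 \<Rightarrow> real" and K where \<theta>: "smooth \<theta>" "\<And>x. 0 \<le> \<theta> x" "\<And>x. \<theta> x \<le> 1" "\<And>x. x \<in> T \<Longrightarrow> 1/2 \<le> \<theta> x"
    and K: "compact K" "K \<subseteq> U" "\<And>x. x \<notin> K \<Longrightarrow> \<theta> x = 0"
    by (rule smooth_cutoff[OF T(1) U(1) T(2)]) (rule that)
  have \<theta>2i: "integrable lborel (\<lambda>x. (\<theta> x)\<^sup>2)"
    using K by (intro integrable_compact_support[of _ K] continuous_intros smooth_continuous \<theta>(1)) auto
  have \<theta>2: "m / 8 \<le> (\<integral>x. (\<theta> x)\<^sup>2 \<partial>lborel)"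
  proof -
    \<comment> \<open>The sign is reversed because \<open>integral_le_indicator_compact\<close>
      estimates from above.\<close>
    have "(\<integral>x. - (\<theta> x)\<^sup>2 \<partial>lborel) \<le> (- 1/4) * measure lborel T"
    proof (rule integral_le_indicator_compact[OF T(1)])
      show "- (\<theta> x)\<^sup>2 \<le> - 1/4 * indicator T x" for x
        using \<theta>(4)[of x] power_mono[of "1/2" "\<theta> x" 2] by (auto simp: indicator_def power2_eq_square)
    qed (use \<theta>2i in simp)
    then show ?thesis using T(3) by simp
  qed
  obtain M where M: "0 \<le> M" "\<And>x. \<bar>\<theta> x\<bar> \<le> M" "\<And>i x. \<bar>pd i \<theta> x\<bar> \<le> M" "\<And>i l x. \<bar>pd l (pd i \<theta>) x\<bar> \<le> M"
    by (rule smooth_bounds[OF \<theta>(1) K(1)]; (erule K(3) | (rule that; assumption)))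
  obtain M' where M': "0 \<le> M'" "\<And>i l m x. \<bar>pd m (pd l (pd i \<psi>)) x\<bar> \<le> M'"
    by (rule smooth_bounds[OF \<psi>(1,2)]; (erule \<psi>(3) | (rule that; assumption)))
  define B where "B = (1 + \<bar>k\<bar>)\<^sup>2 * M'"
  have B: "\<bar>pd l (\<lambda>x. (kap k i)\<^sup>2 * pd l (pd i \<psi>) x) x\<bar> \<le> B" for i l x
  proof -
    have "pd l (\<lambda>x. (kap k i)\<^sup>2 * pd l (pd i \<psi>) x) x = (kap k i)\<^sup>2 * pd l (pd l (pd i \<psi>)) x"
      by (intro pd_cmult smooth_differentiable smooth_pd \<psi>)
    then have "\<bar>pd l (\<lambda>x. (kap k i)\<^sup>2 * pd l (pd i \<psi>) x) x\<bar> = \<bar>kap k i\<bar>\<^sup>2 * \<bar>pd l (pd l (pd i \<psi>)) x\<bar>"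
      by (simp add: abs_mult)
    also have "\<dots> \<le> B" unfolding B_def by (intro mult_mono power_mono abs_kap_le M') auto
    finally show ?thesis .
  qed
  have B0: "0 \<le> B" using M' by (simp add: B_def)
  \<comment> \<open>Since k is not 0, both diagonal directions can be reached. The amplitude
    \<open>a\<close> below is scaled so that the leading part of the oscillation stays on segments
    of half-length \<open>r\<close>.\<close>
  have kj: "kap k j \<noteq> 0" using k by (simp add: kap_def)
  define a where "a = r / \<bar>kap k j\<bar>"
  have a: "a > 0" "\<bar>kap k j * a\<bar> = r" using kj r by (auto simp: a_def abs_mult)
  \<comment> \<open>The segments over \<open>K\<close> together form a compact subset of
    \<open>V\<close>, which has a positive distance \<open>\<rho>\<close> from the complement; an
    error below \<open>\<rho>\<close> cannot leave \<open>V\<close>.\<close>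
  define S where "S = (\<lambda>(x, t). \<eta> + pot_grad k \<psi> x + t *\<^sub>R diag_unit j) ` (K \<times> {-r..r})"
  have "compact S" unfolding S_def case_prod_beta
    by (intro compact_continuous_image compact_Times K compact_Icc continuous_intros
        continuous_on_compose2[OF continuous_pot_grad[OF \<psi>(1), of UNIV]]) auto
  moreover have "S \<inter> - V = {}" using seg K(2) by (auto simp: S_def abs_le_iff)
  ultimately obtain \<rho> where \<rho>: "\<rho> > 0" "\<And>v w. v \<in> S \<Longrightarrow> w \<in> - V \<Longrightarrow> \<rho> \<le> dist v w"
    using separate_compact_closed[of S "- V"] V(1) by (auto simp: closed_Compl)
  define Q1 where "Q1 = 12 * (1 + \<bar>k\<bar>) * M * a"
  define Q2 where "Q2 = 2 * M * a"
  define mK where "mK = measure lborel K"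
  have Q: "0 \<le> Q1" "0 \<le> Q2" "0 \<le> mK" using M a by (auto simp: Q1_def Q2_def mK_def)
  \<comment> \<open>The coefficient of \<open>\<tau>\<close> in the total loss of energy: twice the
    mixed term with its four entries, and the squared gradient error, where one factor
    \<open>\<tau>\<close> is estimated by 1.\<close>
  have "0 \<le> 8 * B * Q2 * mK + Q1\<^sup>2 * mK" using Q B0 by auto
  moreover have "0 < r\<^sup>2 * m / 64" using r m by simp
  ultimately obtain \<tau> where \<tau>: "0 < \<tau>" "\<tau> \<le> 1" "Q1 * \<tau> < \<rho>" "Q2 * \<tau> < \<delta>"
      "(8 * B * Q2 * mK + Q1\<^sup>2 * mK) * \<tau> < r\<^sup>2 * m / 64"
    using small_scale[OF Q(1,2) _ \<rho>(1) \<delta>] by blast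
  obtain p where p: "(\<integral>x. (\<theta> x)\<^sup>2 \<partial>lborel) / 2 \<le> (\<integral>x. (\<theta> x * cos (phase j p \<tau> x))\<^sup>2 \<partial>lborel)"
    using oscillation_phase[OF \<theta>(1) K(1,3)] by blast
  define \<omega> where "\<omega> = osc j a p \<tau> \<theta>"
  define c where "c x = \<theta> x * cos (phase j p \<tau> x)" for x
  have \<omega>: "smooth \<omega>" "\<And>x. x \<notin> K \<Longrightarrow> \<omega> x = 0"
    using K(3) by (auto simp: \<omega>_def smooth_osc \<theta>(1) osc_def)
  have g0: "x \<notin> K \<Longrightarrow> pot_grad k \<omega> x = 0" for x by (rule pot_grad_support[OF K(1) \<omega>(2)])
  have pd\<omega>: "\<bar>pd i \<omega> x\<bar> \<le> Q2 * \<tau>" for i x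
    using osc_bounds(1)[OF \<theta>(1) \<tau>(1,2) M(2-4), of i j a p x] a(1) by (simp add: \<omega>_def Q2_def)
  have err: "norm (pot_grad k \<omega> x + (kap k j * a * c x) *\<^sub>R diag_unit j) \<le> Q1 * \<tau>" for x
    using osc_pot_grad[OF \<theta>(1) \<tau>(1,2) M(2-4), of k j a p x] a(1) by (simp add: \<omega>_def Q1_def c_def)
  have c1: "\<bar>c x\<bar> \<le> 1" for x
    using mult_mono[of "\<bar>\<theta> x\<bar>" 1 "\<bar>cos (phase j p \<tau> x)\<bar>" 1] \<theta>(2,3)[of x] by (simp add: c_def abs_mult)
  have inV: "\<eta> + pot_grad k (\<lambda>x. \<psi> x + \<omega> x) x \<in> V" for x
  proof (cases "x \<in> K")
    case True
    let ?v = "\<eta> + pot_grad k \<psi> x + (- (kap k j * a * c x)) *\<^sub>R diag_unit j"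
    have "\<bar>kap k j * a * c x\<bar> \<le> r"
      using a(2) c1[of x] r by (simp add: abs_mult mult_left_le)
    then have "?v \<in> S" unfolding S_def using True by (intro image_eqI[of _ _ "(x, - (kap k j * a * c x))"]) auto
    moreover have "dist ?v (\<eta> + pot_grad k (\<lambda>x. \<psi> x + \<omega> x) x) < \<rho>"
      using err[of x] \<tau>(3) unfolding pot_grad_add[OF \<psi>(1) \<omega>(1)] dist_norm
      by (subst norm_minus_commute) (simp add: algebra_simps)
    ultimately show ?thesis using \<rho>(2) by (meson ComplI not_le)
  next
    case False
    then show ?thesis using V(2)[of x] g0 by (simp add: pot_grad_add[OF \<psi>(1) \<omega>(1)])
  qed
  have cross: "\<bar>\<integral>x. pot_grad k \<psi> x \<bullet> pot_grad k \<omega> x \<partial>lborel\<bar> \<le> 4 * (B * (Q2 * \<tau>) * mK)"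
    unfolding mK_def by (rule pot_grad_inner_bound[OF \<psi>(1) \<omega>(1) K(1) \<omega>(2) pd\<omega> B])
  have ci: "integrable lborel (\<lambda>x. (c x)\<^sup>2)"
    unfolding c_def using K(3)
    by (intro integrable_compact_support[of _ K] continuous_intros smooth_continuous smooth_phase \<theta>(1) K(1)) auto
  have Ei: "integrable lborel (\<lambda>x. (norm (pot_grad k \<omega> x))\<^sup>2)"
    unfolding power2_norm_eq_inner by (rule integrable_pot_grad_inner[OF \<omega>(1) \<omega>(1) K(1) \<omega>(2)])
  \<comment> \<open>A lower bound for the energy of \<open>\<omega>\<close>, put as an upper bound
    for a difference so that a pointwise inequality on \<open>K\<close> suffices.\<close>
  have "(\<integral>x. r\<^sup>2 / 2 * (c x)\<^sup>2 - (norm (pot_grad k \<omega> x))\<^sup>2 \<partial>lborel) \<le> (Q1 * \<tau>)\<^sup>2 * measure lborel K"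
  proof (rule integral_le_indicator_compact[OF K(1)])
    show "integrable lborel (\<lambda>x. r\<^sup>2 / 2 * (c x)\<^sup>2 - (norm (pot_grad k \<omega> x))\<^sup>2)"
      using ci Ei by auto
    fix x
    show "r\<^sup>2 / 2 * (c x)\<^sup>2 - (norm (pot_grad k \<omega> x))\<^sup>2 \<le> (Q1 * \<tau>)\<^sup>2 * indicator K x"
    proof (cases "x \<in> K")
      case True
      let ?P = "norm (pot_grad k \<omega> x)"
      have nd: "norm (diag_unit j) = 1" by (simp add: diag_unit_def norm_axis_1)
      have "r * \<bar>c x\<bar> = norm ((kap k j * a * c x) *\<^sub>R diag_unit j)"
        using a(2) nd by (simp add: abs_mult)
      also have "\<dots> \<le> ?P + Q1 * \<tau>"
        using err[of x] norm_triangle_ineq4[of "pot_grad k \<omega> x + (kap k j * a * c x) *\<^sub>R diag_unit j" "pot_grad k \<omega> x"]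
        by simp
      finally have "(r * \<bar>c x\<bar>)\<^sup>2 \<le> (?P + Q1 * \<tau>)\<^sup>2" using r by (intro power_mono) auto
      also have "\<dots> \<le> 2 * ?P\<^sup>2 + 2 * (Q1 * \<tau>)\<^sup>2"
        using sum_squares_bound[of ?P "Q1 * \<tau>"] by (simp add: power2_sum)
      finally show ?thesis using True by (simp add: power_mult_distrib)
    next
      case False
      then show ?thesis using K(3) g0 by (simp add: c_def)
    qed
  qed
  then have "r\<^sup>2 / 2 * (\<integral>x. (c x)\<^sup>2 \<partial>lborel) - energy k \<omega> \<le> (Q1 * \<tau>)\<^sup>2 * mK"
    using ci Ei by (simp add: energy_def mK_def)
  moreover have "r\<^sup>2 * m / 32 \<le> r\<^sup>2 / 2 * (\<integral>x. (c x)\<^sup>2 \<partial>lborel)"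
    using mult_left_mono[of "m / 16" "\<integral>x. (c x)\<^sup>2 \<partial>lborel" "r\<^sup>2 / 2"] p \<theta>2 unfolding c_def by simp
  moreover have "(Q1 * \<tau>)\<^sup>2 * mK \<le> Q1\<^sup>2 * mK * \<tau>"
  proof -
    have "\<tau>\<^sup>2 \<le> \<tau>" using \<tau> by (simp add: power2_eq_square mult_left_le_one_le)
    then have "Q1\<^sup>2 * mK * \<tau>\<^sup>2 \<le> Q1\<^sup>2 * mK * \<tau>" using Q by (intro mult_left_mono) auto
    then show ?thesis by (simp add: power_mult_distrib ac_simps)
  qed
  moreover have "2 * \<bar>\<integral>x. pot_grad k \<psi> x \<bullet> pot_grad k \<omega> x \<partial>lborel\<bar> \<le> 8 * B * Q2 * mK * \<tau>"
    using cross by (simp add: algebra_simps)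
  moreover have "8 * B * Q2 * mK * \<tau> + Q1\<^sup>2 * mK * \<tau> < r\<^sup>2 * m / 64"
    using \<tau>(5) by (simp add: algebra_simps)
  ultimately have "energy k \<psi> + r\<^sup>2 * m / 64
      \<le> energy k \<psi> + 2 * (\<integral>x. pot_grad k \<psi> x \<bullet> pot_grad k \<omega> x \<partial>lborel) + energy k \<omega>"
    by linarith
  also have "\<dots> = energy k (\<lambda>x. \<psi> x + \<omega> x)"
    by (rule energy_add[symmetric, OF \<psi>(1,2) _ \<omega>(1) K(1)]) (use \<psi>(3) \<omega>(2) in auto)
  finally have "energy k \<psi> + r\<^sup>2 / 64 * m \<le> energy k (\<lambda>x. \<psi> x + \<omega> x)" by simp
  moreover have "\<bar>pd i \<omega> x\<bar> \<le> \<delta>" for i x using pd\<omega>[of i x] \<tau>(4) by linarith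
  ultimately show thesis using that[OF \<omega>(1) K(1,2) \<omega>(2) inV] unfolding m_def by blast
qed

section \<open>The approximating sequence\<close>

definition admissible :: "(real^2) set \<Rightarrow> real \<Rightarrow> real^2^2 \<Rightarrow> real \<Rightarrow> (real^2 \<Rightarrow> real) \<Rightarrow> bool" where
  "admissible \<Omega> k \<eta> s \<psi> \<longleftrightarrow> smooth \<psi> \<and> (\<exists>C. compact C \<and> C \<subseteq> \<Omega> \<and> (\<forall>x. x \<notin> C \<longrightarrow> \<psi> x = 0)) \<and>
     (\<forall>x. \<eta> + pot_grad k \<psi> x \<in> hull_nbhd s)"

definition bad_set :: "(real^2) set \<Rightarrow> real \<Rightarrow> real^2^2 \<Rightarrow> real \<Rightarrow> (real^2 \<Rightarrow> real) \<Rightarrow> (real^2) set" where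
  "bad_set \<Omega> k \<eta> s \<psi> = {x \<in> \<Omega>. \<eta> + pot_grad k \<psi> x \<notin> near_K s}"

lemma admissibleD:
  assumes "admissible \<Omega> k \<eta> s \<psi>"
  obtains C where "smooth \<psi>" "compact C" "C \<subseteq> \<Omega>" "\<And>x. x \<notin> C \<Longrightarrow> \<psi> x = 0"
    "\<And>x. \<eta> + pot_grad k \<psi> x \<in> hull_nbhd s"
  using assms unfolding admissible_def by blast

text \<open>The complement is the sum of the closed set \<open>- V\<close> and a compact segment,
  and such sums are closed.\<close>

lemma open_segment_interior:
  fixes V :: "'a::real_normed_vector set"
  assumes "open V"
  shows "open {v. \<forall>t. \<bar>t\<bar> \<le> r \<longrightarrow> v + t *\<^sub>R e \<in> V}"
proof -
  have "compact ((\<lambda>t. - t *\<^sub>R e) ` {-r..r})"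
    by (intro compact_continuous_image continuous_intros compact_Icc)
  then have cl: "closed (\<Union>w\<in>-V. \<Union>y\<in>(\<lambda>t. - t *\<^sub>R e) ` {-r..r}. {w + y})"
    using assms by (intro closed_compact_sums) (auto simp: closed_Compl)
  have eq: "(\<Union>w\<in>-V. \<Union>y\<in>(\<lambda>t. - t *\<^sub>R e) ` {-r..r}. {w + y}) = - {v. \<forall>t. \<bar>t\<bar> \<le> r \<longrightarrow> v + t *\<^sub>R e \<in> V}"
    (is "?L = ?R")
  proof (intro set_eqI iffI)
    fix v assume "v \<in> ?R"
    then obtain t where t: "\<bar>t\<bar> \<le> r" "v + t *\<^sub>R e \<in> - V" by auto
    moreover have "v = (v + t *\<^sub>R e) + - t *\<^sub>R e" by simp
    moreover have "- t *\<^sub>R e \<in> (\<lambda>t. - t *\<^sub>R e) ` {-r..r}" using t(1) by (intro imageI) auto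
    ultimately show "v \<in> ?L" by blast
  qed (auto simp: abs_le_iff)
  show ?thesis using cl unfolding eq closed_def double_complement .
qed

lemma open_bad_set:
  assumes "open \<Omega>" "smooth \<psi>"
  shows "open (bad_set \<Omega> k \<eta> s \<psi>)"
proof -
  have "bad_set \<Omega> k \<eta> s \<psi> = \<Omega> \<inter> (\<lambda>x. \<eta> + pot_grad k \<psi> x) -` (- near_K s)"
    by (auto simp: bad_set_def)
  moreover have "open ((\<lambda>x. \<eta> + pot_grad k \<psi> x) -` (- near_K s))"
    by (intro open_vimage open_Compl closed_near_K continuous_intros continuous_pot_grad assms)
  ultimately show ?thesis using assms by auto
qed

lemma measure_bounded_mono:
  fixes A B :: "'a::euclidean_space set"
  assumes "A \<subseteq> B" "A \<in> sets borel" "B \<in> sets borel" "bounded B"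
  shows "measure lborel A \<le> measure lborel B"
  using assms emeasure_bounded_finite[of B] by (intro measure_mono_fmeasurable) (auto simp: fmeasurable_def)

text \<open>Every bad point lies in \<open>U 1\<close> or \<open>U 2\<close>, according to the
  direction of its segment. One of these sets has at least half of the measure, and only its
  direction is used. With r = s/2 the gain is (s/2)^2/64 times 1/2, that is s^2/512.\<close>

lemma improvement_step:
  assumes \<Omega>: "open \<Omega>" "bounded \<Omega>" and s: "0 < s" "s \<le> 1/2" and k: "k \<noteq> 0" and \<delta>: "\<delta> > 0"
    and adm: "admissible \<Omega> k \<eta> s \<psi>"
  shows "\<exists>\<phi>. admissible \<Omega> k \<eta> s \<phi> \<and> (\<forall>x. x \<notin> bad_set \<Omega> k \<eta> s \<psi> \<longrightarrow> pot_grad k \<phi> x = pot_grad k \<psi> x)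
    \<and> (\<forall>i x. \<bar>pd i \<phi> x - pd i \<psi> x\<bar> \<le> \<delta>)
    \<and> energy k \<psi> + s\<^sup>2 / 512 * measure lborel (bad_set \<Omega> k \<eta> s \<psi>) \<le> energy k \<phi>"
proof -
  let ?B = "bad_set \<Omega> k \<eta> s \<psi>"
  obtain C where \<psi>: "smooth \<psi>" and C: "compact C" "C \<subseteq> \<Omega>" "\<And>x. x \<notin> C \<Longrightarrow> \<psi> x = 0"
    and V: "\<And>x. \<eta> + pot_grad k \<psi> x \<in> hull_nbhd s"
    using adm by (rule admissibleD) (rule that)
  have B: "open ?B" "?B \<subseteq> \<Omega>" using open_bad_set[OF \<Omega>(1) \<psi>] by (auto simp: bad_set_def)
  define U where "U j = ?B \<inter> (\<lambda>x. \<eta> + pot_grad k \<psi> x) -`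
      {v. \<forall>t. \<bar>t\<bar> \<le> s / 2 \<longrightarrow> v + t *\<^sub>R diag_unit j \<in> hull_nbhd s}" for j
  have oU: "open (U j)" for j
    unfolding U_def
    by (intro open_Int B open_vimage open_segment_interior open_hull_nbhd continuous_intros continuous_pot_grad \<psi>)
  have bU: "bounded (U j)" "U j \<subseteq> ?B" for j
    using \<Omega>(2) B(2) by (auto simp: U_def intro: bounded_subset)
  have "?B \<subseteq> U 1 \<union> U 2"
  proof
    fix x assume x: "x \<in> ?B"
    then have "\<eta> + pot_grad k \<psi> x \<notin> near_K s" by (simp add: bad_set_def)
    from hull_nbhd_segment[OF s V this] obtain j where "x \<in> U j" using x by (auto simp: U_def)
    then show "x \<in> U 1 \<union> U 2" using exhaust_2[of j] by auto
  qed
  then have "measure lborel ?B \<le> measure lborel (U 1 \<union> U 2)"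
    using oU bU B by (intro measure_bounded_mono) auto
  also have "\<dots> \<le> measure lborel (U 1) + measure lborel (U 2)"
    using oU by (intro measure_Un_le) auto
  finally have "measure lborel ?B / 2 \<le> measure lborel (U 1) \<or> measure lborel ?B / 2 \<le> measure lborel (U 2)"
    by linarith
  then obtain j where j: "measure lborel ?B / 2 \<le> measure lborel (U j)" by blast
  have seg: "\<eta> + pot_grad k \<psi> x + t *\<^sub>R diag_unit j \<in> hull_nbhd s" if "x \<in> U j" "\<bar>t\<bar> \<le> s / 2" for x t
    using that by (auto simp: U_def)
  have s2: "s / 2 > 0" using s by simp
  obtain \<omega> K where \<omega>: "smooth \<omega>" "compact K" "K \<subseteq> U j" "\<And>x. x \<notin> K \<Longrightarrow> \<omega> x = 0"
    "\<And>x. \<eta> + pot_grad k (\<lambda>x. \<psi> x + \<omega> x) x \<in> hull_nbhd s" "\<And>i x. \<bar>pd i \<omega> x\<bar> \<le> \<delta>"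
    "energy k \<psi> + (s / 2)\<^sup>2 / 64 * measure lborel (U j) \<le> energy k (\<lambda>x. \<psi> x + \<omega> x)"
    by (rule oscillation_step[OF \<psi> C(1) C(3) open_hull_nbhd V oU bU(1) seg k s2 \<delta>]; (assumption | (rule that; assumption)))
  show ?thesis
  proof (intro exI[of _ "\<lambda>x. \<psi> x + \<omega> x"] conjI allI impI)
    have "compact (C \<union> K)" "C \<union> K \<subseteq> \<Omega>" "\<forall>x. x \<notin> C \<union> K \<longrightarrow> \<psi> x + \<omega> x = 0"
      using C \<omega>(2-4) bU(2)[of j] B(2) by auto
    then show "admissible \<Omega> k \<eta> s (\<lambda>x. \<psi> x + \<omega> x)"
      unfolding admissible_def using smooth_add[OF \<psi> \<omega>(1)] \<omega>(5) by blast
    show "pot_grad k (\<lambda>x. \<psi> x + \<omega> x) x = pot_grad k \<psi> x" if "x \<notin> ?B" for x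
    proof -
      have "x \<notin> K" using that \<omega>(3) bU(2) by blast
      then show ?thesis
        using pot_grad_support[OF \<omega>(2,4)] by (simp add: pot_grad_add[OF \<psi> \<omega>(1)])
    qed
    show "\<bar>pd i (\<lambda>x. \<psi> x + \<omega> x) x - pd i \<psi> x\<bar> \<le> \<delta>" for i x
      using \<omega>(6)[of i x] by (simp add: pd_smooth_add[OF \<psi> \<omega>(1)])
    have "s\<^sup>2 / 256 * (measure lborel ?B / 2) \<le> s\<^sup>2 / 256 * measure lborel (U j)"
      using j by (intro mult_left_mono) auto
    then show "energy k \<psi> + s\<^sup>2 / 512 * measure lborel ?B \<le> energy k (\<lambda>x. \<psi> x + \<omega> x)"
      using \<omega>(7) by (simp add: power_divide)
  qed
qed

section \<open>Uniform bounds and geometric convergence\<close>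

lemma admissible_bound:
  assumes adm: "admissible \<Omega> k \<eta> s \<psi>" and s: "0 < s" "s \<le> 1/2" and \<eta>: "\<eta> \<in> hull_nbhd s"
  shows "norm (pot_grad k \<psi> x) \<le> 32"
proof -
  have "\<eta> + pot_grad k \<psi> x \<in> hull_nbhd s" using adm by (simp add: admissible_def)
  from hull_nbhd_bounded[OF this s] hull_nbhd_bounded[OF \<eta> s]
  show ?thesis using norm_triangle_ineq4[of "\<eta> + pot_grad k \<psi> x" \<eta>] by simp
qed

text \<open>The ceiling, common to all admissible potentials, that makes the gains summable.\<close>

lemma energy_bound:
  assumes \<Omega>: "open \<Omega>" "bounded \<Omega>" and adm: "admissible \<Omega> k \<eta> s \<psi>" and s: "0 < s" "s \<le> 1/2"
    and \<eta>: "\<eta> \<in> hull_nbhd s"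
  shows "energy k \<psi> \<le> 32\<^sup>2 * measure lborel \<Omega>"
proof -
  obtain C where \<psi>: "smooth \<psi>" and C: "compact C" "C \<subseteq> \<Omega>" "\<And>x. x \<notin> C \<Longrightarrow> \<psi> x = 0"
    using adm by (rule admissibleD) (rule that)
  have "energy k \<psi> \<le> 32\<^sup>2 * measure lborel C"
    unfolding energy_def
  proof (rule integral_le_indicator_compact[OF C(1)])
    show "integrable lborel (\<lambda>x. (norm (pot_grad k \<psi> x))\<^sup>2)"
      unfolding power2_norm_eq_inner
      by (rule integrable_pot_grad_inner[OF \<psi> \<psi> C(1)]) (rule C(3))
    show "(norm (pot_grad k \<psi> x))\<^sup>2 \<le> 32\<^sup>2 * indicator C x" for x
    proof (cases "x \<in> C")
      case True
      then show ?thesis using power_mono[OF admissible_bound[OF adm s \<eta>], of x 2] by simp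
    next
      case False
      then show ?thesis using pot_grad_support[OF C(1,3)] by simp
    qed
  qed
  also have "\<dots> \<le> 32\<^sup>2 * measure lborel \<Omega>"
    using C \<Omega> compact_imp_closed[OF C(1)] by (intro mult_left_mono measure_bounded_mono) auto
  finally show ?thesis .
qed

text \<open>The limit is a telescoping series. The explicit rate is kept because its case n = 0
  later bounds the limit itself.\<close>

lemma geometric_limit:
  fixes f :: "nat \<Rightarrow> 'a::banach"
  assumes "\<And>n. norm (f (Suc n) - f n) \<le> c * (1/2) ^ n"
  shows "\<exists>l. \<forall>n. norm (l - f n) \<le> 2 * c * (1/2) ^ n"
proof -
  have sg: "summable (\<lambda>i. c * (1/2::real) ^ (i + n))" "(\<Sum>i. c * (1/2) ^ (i + n)) = 2 * c * (1/2) ^ n" for n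
    using suminf_geometric[of "1/2::real"]
    by (auto simp: power_add suminf_mult suminf_mult2[symmetric] summable_mult summable_geometric
        simp flip: mult.assoc intro!: summable_mult2)
  have d: "norm (f (Suc (i + n)) - f (i + n)) \<le> c * (1/2) ^ (i + n)" for i n
    by (rule assms)
  have s: "summable (\<lambda>i. f (Suc i) - f i)"
    by (rule summable_comparison_test'[where g = "\<lambda>i. c * (1/2) ^ (i + 0)" and N = 0])
       (use sg(1)[of 0] assms in auto)
  define l where "l = f 0 + (\<Sum>i. f (Suc i) - f i)"
  have "norm (l - f n) \<le> 2 * c * (1/2) ^ n" for n
  proof -
    have "(\<Sum>i. f (Suc i) - f i) = (\<Sum>i. f (Suc (i + n)) - f (i + n)) + (\<Sum>i<n. f (Suc i) - f i)"
      using suminf_split_initial_segment[OF s, of n] by simp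
    then have "l - f n = (\<Sum>i. f (Suc (i + n)) - f (i + n))"
      by (simp add: l_def sum_lessThan_telescope)
    also have "norm \<dots> \<le> (\<Sum>i. c * (1/2) ^ (i + n))"
      by (rule norm_suminf_le[OF d sg(1)])
    finally show ?thesis by (simp only: sg(2))
  qed
  then show ?thesis by blast
qed

lemma approximating_sequence:
  assumes \<Omega>: "open \<Omega>" "bounded \<Omega>" and s: "0 < s" "s \<le> 1/2" and k: "k \<noteq> 0" and \<delta>: "\<delta> > 0"
    and \<eta>: "\<eta> \<in> hull_nbhd s"
  obtains \<psi> :: "nat \<Rightarrow> real^2 \<Rightarrow> real" and w Z where
    "\<And>n. admissible \<Omega> k \<eta> s (\<psi> n)"
    "\<And>n x. norm (w x - pot_field k (\<psi> n) x) \<le> \<delta> * (1/2) ^ n"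
    "\<And>x. norm (w x) \<le> \<delta>"
    "Z \<in> null_sets lborel"
    "\<And>x. x \<notin> Z \<Longrightarrow> \<exists>N. (\<forall>n\<ge>N. pot_grad k (\<psi> n) x = pot_grad k (\<psi> N) x)
        \<and> (x \<in> \<Omega> \<longrightarrow> \<eta> + pot_grad k (\<psi> N) x \<in> near_K s)"
proof -
  \<comment> \<open>Two components, each with weight at most 1 + |k|, turn this into \<delta>/2
    times (1/2)^n for the fields, and summing the tail doubles it.\<close>
  define d where "d n = \<delta> / (4 * (1 + \<bar>k\<bar>)) * (1/2) ^ n" for n :: nat
  have d: "d n > 0" for n using \<delta> by (simp add: d_def)
  let ?B = "bad_set \<Omega> k \<eta> s"
  \<comment> \<open>The start at the zero potential makes the estimate for n = 0 the bound of
    \<open>w\<close> by \<delta>.\<close>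
  have "\<exists>\<psi>. \<forall>n. (admissible \<Omega> k \<eta> s (\<psi> n) \<and> (n = 0 \<longrightarrow> \<psi> n = (\<lambda>x. 0)))
    \<and> ((\<forall>x. x \<notin> ?B (\<psi> n) \<longrightarrow> pot_grad k (\<psi> (Suc n)) x = pot_grad k (\<psi> n) x)
    \<and> (\<forall>i x. \<bar>pd i (\<psi> (Suc n)) x - pd i (\<psi> n) x\<bar> \<le> d n)
    \<and> energy k (\<psi> n) + s\<^sup>2 / 512 * measure lborel (?B (\<psi> n)) \<le> energy k (\<psi> (Suc n)))"
  proof (rule dependent_nat_choice)
    have "pot_grad k (\<lambda>x. 0) x = 0" for x
      by (rule pot_grad_support[of "{}"]) auto
    then have "admissible \<Omega> k \<eta> s (\<lambda>x. 0)"
      using \<eta> unfolding admissible_def by (auto simp: smooth_const intro: exI[of _ "{}"])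
    then show "\<exists>\<psi>. admissible \<Omega> k \<eta> s \<psi> \<and> (0 = (0::nat) \<longrightarrow> \<psi> = (\<lambda>x. 0))" by blast
  next
    fix \<psi> :: "real^2 \<Rightarrow> real" and n :: nat
    assume "admissible \<Omega> k \<eta> s \<psi> \<and> (n = 0 \<longrightarrow> \<psi> = (\<lambda>x. 0))"
    then show "\<exists>\<phi>. (admissible \<Omega> k \<eta> s \<phi> \<and> (Suc n = 0 \<longrightarrow> \<phi> = (\<lambda>x. 0)))
      \<and> ((\<forall>x. x \<notin> ?B \<psi> \<longrightarrow> pot_grad k \<phi> x = pot_grad k \<psi> x)
      \<and> (\<forall>i x. \<bar>pd i \<phi> x - pd i \<psi> x\<bar> \<le> d n)
      \<and> energy k \<psi> + s\<^sup>2 / 512 * measure lborel (?B \<psi>) \<le> energy k \<phi>)"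
      using improvement_step[OF \<Omega> s k d[of n]] by blast
  qed
  then obtain \<psi> where adm: "\<And>n. admissible \<Omega> k \<eta> s (\<psi> n)" and \<psi>0: "\<psi> 0 = (\<lambda>x. 0)"
    and same: "\<And>n x. x \<notin> ?B (\<psi> n) \<Longrightarrow> pot_grad k (\<psi> (Suc n)) x = pot_grad k (\<psi> n) x"
    and close: "\<And>n i x. \<bar>pd i (\<psi> (Suc n)) x - pd i (\<psi> n) x\<bar> \<le> d n"
    and gain: "\<And>n. energy k (\<psi> n) + s\<^sup>2 / 512 * measure lborel (?B (\<psi> n)) \<le> energy k (\<psi> (Suc n))"
    by metis
  define m where "m n = measure lborel (?B (\<psi> n))" for n
  have sm: "smooth (\<psi> n)" for n using adm by (simp add: admissible_def)
  have Bs: "open (?B (\<psi> n))" "?B (\<psi> n) \<subseteq> \<Omega>" for n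
    using open_bad_set[OF \<Omega>(1) sm] by (auto simp: bad_set_def)
  \<comment> \<open>Together with \<open>energy_bound\<close> this makes the measures
    \<open>m\<close> of the bad sets summable, so they tend to 0.\<close>
  have tele: "s\<^sup>2 / 512 * (\<Sum>i<n. m i) + energy k (\<psi> 0) \<le> energy k (\<psi> n)" for n
  proof (induction n)
    case (Suc n)
    then show ?case using gain[of n] by (simp add: m_def distrib_left)
  qed simp
  have E0: "0 \<le> energy k (\<psi> 0)" by (simp add: energy_def)
  have "(\<Sum>i<n. m i) \<le> 512 / s\<^sup>2 * (32\<^sup>2 * measure lborel \<Omega>)" for n
  proof -
    have "s\<^sup>2 / 512 * (\<Sum>i<n. m i) \<le> 32\<^sup>2 * measure lborel \<Omega>"
      using tele[of n] E0 energy_bound[OF \<Omega> adm s \<eta>, of n] by linarith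
    then show ?thesis using s by (simp add: field_simps)
  qed
  then have "summable m"
    by (intro summableI_nonneg_bounded) (auto simp: m_def)
  then have m0: "m \<longlonglongrightarrow> 0" by (rule summable_LIMSEQ_zero)
  \<comment> \<open>The points that are bad at every stage. The measure of this set is below every
    \<open>m n\<close>, so it is a null set.\<close>
  define Z where "Z = (\<Inter>n. ?B (\<psi> n))"
  have Zs: "Z \<in> sets borel" unfolding Z_def using Bs(1) by (intro sets.countable_INT) auto
  have "measure lborel Z \<le> m n" for n
    unfolding m_def using Zs Bs bounded_subset[OF \<Omega>(2)] by (intro measure_bounded_mono) (auto simp: Z_def)
  then have "measure lborel Z \<le> 0" using LIMSEQ_le_const[OF m0] by blast
  moreover have "emeasure lborel Z < \<infinity>"
    using Bs(2) \<Omega>(2) by (intro emeasure_bounded_finite bounded_subset[OF \<Omega>(2)]) (auto simp: Z_def)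
  ultimately have Z0: "Z \<in> null_sets lborel"
    using Zs by (auto simp: null_sets_def measure_le_0_iff measure_eq_emeasure_eq_ennreal emeasure_eq_ennreal_measure)
  \<comment> \<open>Outside the current bad set the gradient is unchanged, so a good point remains
    good at the next stage, and its gradient is frozen from stage \<open>N\<close> on.\<close>
  have stay: "x \<notin> ?B (\<psi> (N + n)) \<and> pot_grad k (\<psi> (N + n)) x = pot_grad k (\<psi> N) x" if "x \<notin> ?B (\<psi> N)" for x N n
  proof (induction n)
    case (Suc n)
    then have "pot_grad k (\<psi> (Suc (N + n))) x = pot_grad k (\<psi> (N + n)) x" using same by blast
    with Suc show ?case by (auto simp: bad_set_def)
  qed (use that in simp)
  have fclose: "norm (pot_field k (\<psi> (Suc n)) x - pot_field k (\<psi> n) x) \<le> \<delta> / 2 * (1/2) ^ n" for n x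
  proof -
    have c: "\<bar>(pot_field k (\<psi> (Suc n)) x - pot_field k (\<psi> n) x) $ i\<bar> \<le> (1 + \<bar>k\<bar>) * d n" for i
    proof -
      have "(pot_field k (\<psi> (Suc n)) x - pot_field k (\<psi> n) x) $ i = kap k i * (pd i (\<psi> (Suc n)) x - pd i (\<psi> n) x)"
        by (simp add: pot_field_def algebra_simps)
      then show ?thesis by (simp only: abs_mult) (intro mult_mono abs_kap_le close, auto)
    qed
    have "norm (pot_field k (\<psi> (Suc n)) x - pot_field k (\<psi> n) x) \<le> (\<Sum>i\<in>(UNIV::2 set). (1 + \<bar>k\<bar>) * d n)"
      by (rule order_trans[OF norm_le_l1_cart sum_mono[OF c]])
    also have "\<dots> = \<delta> / 2 * (1/2) ^ n"
    proof -
      define c where "c = 1 + \<bar>k\<bar>"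
      have "c \<noteq> 0" unfolding c_def by linarith
      then show ?thesis unfolding d_def c_def[symmetric] by simp
    qed
    finally show ?thesis .
  qed
  have "\<forall>x. \<exists>l. \<forall>n. norm (l - pot_field k (\<psi> n) x) \<le> 2 * (\<delta> / 2) * (1/2) ^ n"
    by (intro allI geometric_limit fclose)
  then obtain w where w: "\<And>x n. norm (w x - pot_field k (\<psi> n) x) \<le> \<delta> * (1/2) ^ n"
    by (force dest!: choice)
  show thesis
  proof (rule that[OF adm w _ Z0])
    have "pot_field k (\<psi> 0) x = 0" for x by (simp add: \<psi>0 pot_field_def pd_const vec_eq_iff)
    then show "norm (w x) \<le> \<delta>" for x using w[of x 0] by simp
    fix x assume "x \<notin> Z"
    then obtain N where N: "x \<notin> ?B (\<psi> N)" by (auto simp: Z_def)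
    show "\<exists>N. (\<forall>n\<ge>N. pot_grad k (\<psi> n) x = pot_grad k (\<psi> N) x)
        \<and> (x \<in> \<Omega> \<longrightarrow> \<eta> + pot_grad k (\<psi> N) x \<in> near_K s)"
      using stay[OF N] N by (intro exI[of _ N]) (auto simp: le_iff_add bad_set_def)
  qed
qed

section \<open>Passage to the limit\<close>

lemma integrable_lebesgue: "integrable lborel f \<Longrightarrow> integrable lebesgue f"
  for f :: "'a::euclidean_space \<Rightarrow> 'b::{banach,second_countable_topology}"
  using integrable_completion[of f lborel] borel_measurable_integrable by blast

lemma geometric_tendsto_0: "(\<lambda>n. c * (1/2::real) ^ n) \<longlonglongrightarrow> 0"
  using tendsto_mult[OF tendsto_const LIMSEQ_realpow_zero[of "1/2::real"], of c] by simp

lemma geometric_LIMSEQ: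
  fixes f :: "nat \<Rightarrow> 'a::real_normed_vector"
  assumes "\<And>n. norm (l - f n) \<le> c * (1/2) ^ n"
  shows "f \<longlonglongrightarrow> l"
proof -
  have "(\<lambda>n. f n - l) \<longlonglongrightarrow> 0"
    by (rule Lim_null_comparison[OF _ geometric_tendsto_0[of c]])
       (use assms in \<open>auto simp: norm_minus_commute\<close>)
  then show ?thesis by (simp add: LIM_zero_iff)
qed

lemma continuous_geometric_limit:
  fixes v :: "nat \<Rightarrow> 'a::topological_space \<Rightarrow> 'b::real_normed_vector"
  assumes "\<And>n. continuous_on UNIV (v n)" "\<And>n x. norm (w x - v n x) \<le> c * (1/2) ^ n"
  shows "continuous_on UNIV w"
proof (rule uniform_limit_theorem)
  show "uniform_limit UNIV v w sequentially"
  proof (rule uniform_limitI)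
    fix e :: real assume "e > 0"
    then have "\<forall>\<^sub>F n in sequentially. c * (1/2) ^ n < e"
      using order_tendstoD(2)[OF geometric_tendsto_0] by blast
    then show "\<forall>\<^sub>F n in sequentially. \<forall>x\<in>UNIV. dist (v n x) (w x) < e"
    proof (rule eventually_mono)
      fix n assume "c * (1/2) ^ n < e"
      then show "\<forall>x\<in>UNIV. dist (v n x) (w x) < e"
        using assms(2) by (metis dist_commute dist_norm le_less_trans)
    qed
  qed
qed (use assms(1) in auto)

lemma set_lebesgue_integral_support:
  fixes f :: "real^'n \<Rightarrow> real"
  assumes "f \<in> borel_measurable borel" "\<And>x. x \<notin> \<Omega> \<Longrightarrow> f x = 0"
  shows "(LINT x:\<Omega>|lebesgue. f x) = (\<integral>x. f x \<partial>lborel)"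
proof -
  have "(\<lambda>x. indicator \<Omega> x *\<^sub>R f x) = f"
    using assms(2) by (intro ext) (auto simp: indicator_def)
  then show ?thesis
    using assms(1) by (simp add: set_lebesgue_integral_def integral_completion)
qed

text \<open>Integration by parts holds for each smooth \<open>v n\<close>, and both sides converge
  by dominated convergence: the functions converge uniformly, the gradients are bounded and converge
  off a null set. Thus \<open>w\<close> itself never has to be differentiated.\<close>

lemma weak_gradient_limit:
  fixes v :: "nat \<Rightarrow> real^'n \<Rightarrow> real^'m"
  assumes sm: "\<And>n. smooth (v n)"
    and unif: "\<And>n x. norm (w x - v n x) \<le> c * (1/2) ^ n"
    and bd: "\<And>n x. norm (jacobian (v n) (at x)) \<le> M"
    and G: "G \<in> borel_measurable borel" "\<And>x. norm (G x) \<le> M"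
    and Z: "Z \<in> null_sets lborel"
    and conv: "\<And>x. x \<notin> Z \<Longrightarrow> (\<lambda>n. jacobian (v n) (at x)) \<longlonglongrightarrow> G x"
  shows "has_weak_gradient \<Omega> w G"
  unfolding has_weak_gradient_def
proof (intro conjI allI impI)
  have wc: "continuous_on UNIV w"
    by (rule continuous_geometric_limit[OF smooth_continuous[OF sm] unif])
  show "locally_integrable \<Omega> w"
    unfolding locally_integrable_def set_integrable_def
    by (intro allI impI integrable_lebesgue borel_integrable_compact continuous_on_subset[OF wc]) auto
  show "locally_integrable \<Omega> G"
    unfolding locally_integrable_def set_integrable_def
  proof (intro allI impI integrable_lebesgue)
    fix C assume C: "compact C \<and> C \<subseteq> \<Omega>"
    show "integrable lborel (\<lambda>x. indicator C x *\<^sub>R G x)"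
    proof (rule Bochner_Integration.integrable_bound)
      show "integrable lborel (\<lambda>x::real^'n. indicator C x *\<^sub>R M)"
        using C by (intro borel_integrable_compact) auto
      show "(\<lambda>x. indicator C x *\<^sub>R G x) \<in> borel_measurable lborel"
        using G(1) C compact_imp_closed[of C] by (intro borel_measurable_scaleR) auto
      show "AE x in lborel. norm (indicator C x *\<^sub>R G x) \<le> norm (indicator C x *\<^sub>R M)"
        using order_trans[OF G(2) abs_ge_self] by (intro AE_I2) (auto simp: indicator_def)
    qed
  qed
next
  fix \<phi> :: "real^'n \<Rightarrow> real" and i j
  assume "test_function \<Omega> \<phi>"
  then obtain C where \<phi>: "smooth \<phi>" and C: "compact C" "C \<subseteq> \<Omega>" "\<And>x. x \<notin> C \<Longrightarrow> \<phi> x = 0"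
    by (auto simp: test_function_def smooth_def)
  have d0: "x \<notin> C \<Longrightarrow> pd j \<phi> x = 0" for x by (rule pd_support[OF C(1,3)])
  have wc: "continuous_on UNIV w"
    by (rule continuous_geometric_limit[OF smooth_continuous[OF sm] unif])
  note dm[measurable] = smooth_measurable[OF smooth_pd[OF \<phi>], of j]
  note \<phi>m[measurable] = smooth_measurable[OF \<phi>]
  have wm[measurable]: "(\<lambda>x. w x $ i) \<in> borel_measurable borel"
    by (intro borel_measurable_continuous_onI continuous_intros wc)
  have Gm[measurable]: "(\<lambda>x. G x $ i $ j) \<in> borel_measurable borel"
  proof -
    have "continuous_on UNIV (\<lambda>y::real^'n^'m. y $ i $ j)" by (intro continuous_intros)
    from borel_measurable_continuous_onI[OF this] G(1) show ?thesis by (rule measurable_compose_rev)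
  qed
  have vs: "smooth (\<lambda>x. v n x $ i)" for n
    by (rule smooth_linear[OF bounded_linear_vec_nth sm])
  have ibp: "(\<integral>x. v n x $ i * pd j \<phi> x \<partial>lborel) = - (\<integral>x. jacobian (v n) (at x) $ i $ j * \<phi> x \<partial>lborel)" for n
    using integration_by_parts[OF vs \<phi> C(1), of n j] C(3) by (simp add: jacobian_nth sm)
  have vlim: "(\<lambda>n. v n x $ i) \<longlonglongrightarrow> w x $ i" for x
    by (intro tendsto_vec_nth geometric_LIMSEQ[OF unif])
  have "(\<lambda>n. \<integral>x. v n x $ i * pd j \<phi> x \<partial>lborel) \<longlonglongrightarrow> (\<integral>x. w x $ i * pd j \<phi> x \<partial>lborel)"
  proof (rule integral_dominated_convergence[where w = "\<lambda>x. (norm (w x) + \<bar>c\<bar>) * \<bar>pd j \<phi> x\<bar>"])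
    show "integrable lborel (\<lambda>x. (norm (w x) + \<bar>c\<bar>) * \<bar>pd j \<phi> x\<bar>)"
      using d0 by (intro integrable_compact_support[OF _ C(1)] continuous_intros wc smooth_continuous smooth_pd \<phi>) auto
    show "(\<lambda>x. v n x $ i * pd j \<phi> x) \<in> borel_measurable lborel" for n
      using smooth_measurable[OF vs, of n] by measurable
    show "AE x in lborel. norm (v n x $ i * pd j \<phi> x) \<le> (norm (w x) + \<bar>c\<bar>) * \<bar>pd j \<phi> x\<bar>" for n
    proof (rule AE_I2)
      fix x
      have "c * (1/2) ^ n \<le> \<bar>c\<bar> * 1" by (intro mult_mono power_le_one) auto
      then have "norm (w x - v n x) \<le> \<bar>c\<bar>" using unif[of x n] by simp
      moreover have "norm (v n x) \<le> norm (w x) + norm (w x - v n x)"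
        using norm_triangle_ineq4[of "w x" "w x - v n x"] by simp
      ultimately have "norm (v n x) \<le> norm (w x) + \<bar>c\<bar>" by linarith
      then have "\<bar>v n x $ i\<bar> \<le> norm (w x) + \<bar>c\<bar>"
        using component_le_norm_cart[of "v n x" i] by linarith
      then show "norm (v n x $ i * pd j \<phi> x) \<le> (norm (w x) + \<bar>c\<bar>) * \<bar>pd j \<phi> x\<bar>"
        by (simp add: abs_mult mult_right_mono)
    qed
    show "AE x in lborel. (\<lambda>n. v n x $ i * pd j \<phi> x) \<longlonglongrightarrow> w x $ i * pd j \<phi> x"
      by (intro AE_I2 tendsto_mult vlim tendsto_const)
  qed measurable
  moreover have "(\<lambda>n. \<integral>x. jacobian (v n) (at x) $ i $ j * \<phi> x \<partial>lborel) \<longlonglongrightarrow> (\<integral>x. G x $ i $ j * \<phi> x \<partial>lborel)"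
  proof (rule integral_dominated_convergence[where w = "\<lambda>x. M * \<bar>\<phi> x\<bar>"])
    show "integrable lborel (\<lambda>x. M * \<bar>\<phi> x\<bar>)"
      using C(3) by (intro integrable_compact_support[OF _ C(1)] continuous_intros smooth_continuous \<phi>) auto
    show "(\<lambda>x. jacobian (v n) (at x) $ i $ j * \<phi> x) \<in> borel_measurable lborel" for n
      using smooth_measurable[OF smooth_pd[OF vs], of j n] by (simp add: jacobian_nth sm)
    show "AE x in lborel. norm (jacobian (v n) (at x) $ i $ j * \<phi> x) \<le> M * \<bar>\<phi> x\<bar>" for n
    proof (rule AE_I2)
      fix x
      have "\<bar>jacobian (v n) (at x) $ i $ j\<bar> \<le> M"
        using component_le_norm_cart[of "jacobian (v n) (at x) $ i" j]
          Finite_Cartesian_Product.norm_nth_le[of "jacobian (v n) (at x)" i] bd[of n x] by linarith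
      then show "norm (jacobian (v n) (at x) $ i $ j * \<phi> x) \<le> M * \<bar>\<phi> x\<bar>"
        by (simp add: abs_mult mult_right_mono)
    qed
    show "AE x in lborel. (\<lambda>n. jacobian (v n) (at x) $ i $ j * \<phi> x) \<longlonglongrightarrow> G x $ i $ j * \<phi> x"
      by (rule AE_I'[OF Z]) (use conv in \<open>auto intro!: tendsto_mult tendsto_vec_nth\<close>)
  qed measurable
  ultimately have eq: "(\<integral>x. w x $ i * pd j \<phi> x \<partial>lborel) = - (\<integral>x. G x $ i $ j * \<phi> x \<partial>lborel)"
    unfolding ibp using LIMSEQ_unique tendsto_minus by blast
  have "(LINT x:\<Omega>|lebesgue. w x $ i * pd j \<phi> x) = (\<integral>x. w x $ i * pd j \<phi> x \<partial>lborel)"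
    using d0 C(2) by (intro set_lebesgue_integral_support) auto
  moreover have "(LINT x:\<Omega>|lebesgue. G x $ i $ j * \<phi> x) = (\<integral>x. G x $ i $ j * \<phi> x \<partial>lborel)"
    using C(2,3) by (intro set_lebesgue_integral_support) auto
  ultimately show "(LINT x:\<Omega>|lebesgue. w x $ i * frechet_derivative \<phi> (at x) (axis j 1)) =
      - (LINT x:\<Omega>|lebesgue. G x $ i $ j * \<phi> x)"
    using eq by (simp add: pd_def)
qed

section \<open>Essential bounds, almost-everywhere statements and the affine part\<close>

lemma borel_measurable_lebesgue_on:
  fixes f :: "real^'n \<Rightarrow> 'b::euclidean_space"
  assumes "f \<in> borel_measurable borel"
  shows "f \<in> borel_measurable (lebesgue_on \<Omega>)"
  using assms by (intro measurable_restrict_space1) (simp add: measurable_completion)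

lemma Linf_norm_le:
  fixes f :: "real^'n \<Rightarrow> 'b::euclidean_space"
  assumes "f \<in> borel_measurable borel" "\<And>x. x \<in> \<Omega> \<Longrightarrow> norm (f x) \<le> c"
  shows "Linf_norm \<Omega> f \<le> ereal c"
  unfolding Linf_norm_def
proof (rule esssup_I)
  show "(\<lambda>x. ereal (norm (f x))) \<in> borel_measurable (lebesgue_on \<Omega>)"
    using borel_measurable_lebesgue_on[OF assms(1)] by measurable
  show "AE x in lebesgue_on \<Omega>. ereal (norm (f x)) \<le> ereal c"
    using assms(2) by (intro AE_I2) (simp add: space_restrict_space)
qed

lemma Linf_bounded:
  fixes f :: "real^'n \<Rightarrow> 'b::euclidean_space"
  assumes "f \<in> borel_measurable borel" "\<And>x. x \<in> \<Omega> \<Longrightarrow> norm (f x) \<le> c"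
  shows "f \<in> Linf \<Omega>"
proof -
  have "Linf_norm \<Omega> f \<le> ereal c" by (rule Linf_norm_le[OF assms])
  also have "\<dots> < \<infinity>" by simp
  finally show ?thesis using borel_measurable_lebesgue_on[OF assms(1)] by (simp add: Linf_def)
qed

lemma AE_lebesgue_on:
  assumes "Z \<in> null_sets lborel" "\<And>x. x \<in> \<Omega> \<Longrightarrow> x \<notin> Z \<Longrightarrow> P x" "\<Omega> \<in> sets borel"
  shows "AE x in lebesgue_on \<Omega>. P x"
proof -
  have "AE x in lebesgue. x \<in> \<Omega> \<longrightarrow> P x"
    by (rule AE_I'[OF null_sets_completionI[OF assms(1)]]) (use assms(2) in auto)
  then show ?thesis using assms(3) by (subst AE_restrict_space_iff) auto
qed

lemma test_function_pot_field:
  assumes "admissible \<Omega> k \<eta> s \<psi>"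
  shows "test_function \<Omega> (pot_field k \<psi>)"
proof -
  obtain C where C: "smooth \<psi>" "compact C" "C \<subseteq> \<Omega>" "\<And>x. x \<notin> C \<Longrightarrow> \<psi> x = 0"
    using assms by (rule admissibleD) (rule that)
  have "x \<notin> C \<Longrightarrow> pot_field k \<psi> x = 0" for x
    using pd_support[OF C(2,4)] by (simp add: pot_field_def vec_eq_iff)
  then show ?thesis
    using C smooth_pot_field[OF C(1), of k] by (auto simp: test_function_def smooth_def)
qed

lemma smooth_affine_map: "smooth (affine_map \<eta> \<gamma>)"
proof -
  have "smooth (\<lambda>x. \<eta> *v x + \<gamma>)"
    by (intro smooth_add smooth_const smooth_linear[OF matrix_vector_mul_bounded_linear smooth_id])
  moreover have "affine_map \<eta> \<gamma> = (\<lambda>x. \<eta> *v x + \<gamma>)" by (simp add: affine_map_def fun_eq_iff)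
  ultimately show ?thesis by simp
qed

lemma jacobian_affine_map_add:
  assumes "smooth f"
  shows "jacobian (\<lambda>x. affine_map \<eta> \<gamma> x + f x) (at x) = \<eta> + jacobian f (at x)"
proof -
  have "(affine_map \<eta> \<gamma> has_derivative (\<lambda>h. \<eta> *v h)) (at x)"
    unfolding affine_map_def
    by (auto intro!: derivative_eq_intros bounded_linear.has_derivative[OF matrix_vector_mul_bounded_linear])
  from has_derivative_add[OF this smooth_has_derivative[OF assms, of x]]
  have "frechet_derivative (\<lambda>x. affine_map \<eta> \<gamma> x + f x) (at x) = (\<lambda>h. \<eta> *v h + frechet_derivative f (at x) h)"
    by (rule frechet_derivative_at[symmetric])
  then show ?thesis
    by (simp add: jacobian_def matrix_def vec_eq_iff matrix_vector_mult_basis column_def)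
qed

text \<open>On a bounded set the constant c is an integrable majorant. This is the form in which
  both convergences of \<open>W11_0\<close> are obtained.\<close>

lemma nn_integral_dominated_null:
  fixes f :: "nat \<Rightarrow> real^'n \<Rightarrow> real"
  assumes "\<And>n. f n \<in> borel_measurable borel" "\<And>n x. 0 \<le> f n x \<and> f n x \<le> c"
    and "Z \<in> null_sets lborel" "\<And>x. x \<notin> Z \<Longrightarrow> (\<lambda>n. f n x) \<longlonglongrightarrow> 0"
    and \<Omega>: "\<Omega> \<in> sets borel" "bounded \<Omega>"
  shows "(\<lambda>n. \<integral>\<^sup>+x\<in>\<Omega>. ennreal (f n x) \<partial>lebesgue) \<longlonglongrightarrow> 0"
proof -
  have "(\<lambda>n. \<integral>\<^sup>+x. ennreal (f n x) * indicator \<Omega> x \<partial>lborel) \<longlonglongrightarrow> (\<integral>\<^sup>+x. 0 \<partial>(lborel :: (real^'n) measure))"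
  proof (rule nn_integral_dominated_convergence[where w = "\<lambda>x. ennreal c * indicator \<Omega> x"])
    show "(\<lambda>x. ennreal (f n x) * indicator \<Omega> x) \<in> borel_measurable lborel" for n
      using assms(1)[of n] \<Omega>(1) by measurable
    show "(\<lambda>x. ennreal c * indicator \<Omega> x) \<in> borel_measurable lborel"
      using \<Omega>(1) by measurable
    show "AE x in lborel. ennreal (f n x) * indicator \<Omega> x \<le> ennreal c * indicator \<Omega> x" for n
      using assms(2) by (intro AE_I2 mult_right_mono ennreal_leI) auto
    show "(\<integral>\<^sup>+x. ennreal c * indicator \<Omega> x \<partial>lborel) < \<infinity>"
      using emeasure_bounded_finite[OF \<Omega>(2)] \<Omega>(1)
      by (simp add: nn_integral_cmult ennreal_mult_less_top)
    have "(\<lambda>n. ennreal (f n x) * indicator \<Omega> x) \<longlonglongrightarrow> 0" if "x \<notin> Z" for x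
    proof (cases "x \<in> \<Omega>")
      case True
      then show ?thesis using tendsto_ennrealI[OF assms(4)[OF that]] by simp
    qed simp
    then show "AE x in lborel. (\<lambda>n. ennreal (f n x) * indicator \<Omega> x) \<longlonglongrightarrow> 0"
      by (intro AE_I'[OF assms(3)]) auto
  qed auto
  then show ?thesis
    using assms(1) \<Omega>(1) by (simp add: nn_integral_completion)
qed

theorem corollary1p5:
  fixes \<Omega> :: "(real^2) set" and k \<epsilon> :: real and \<eta> :: "real^2^2" and \<gamma> :: "real^2"
  assumes "bounded_lipschitz_domain \<Omega>"
    and "k \<noteq> 0"
    and "\<eta> \<in> rc_hull K_set"
    and "\<epsilon> > 0"
  shows "\<exists>u \<in> W1inf \<Omega>. \<exists>G. has_weak_gradient \<Omega> u G \<and>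
           (AE x in lebesgue_on \<Omega>. infdist (G x) K_set < \<epsilon>) \<and>
           (AE x in lebesgue_on \<Omega>. L_form k (G x) = 0) \<and>
           (\<lambda>x. u x - affine_map \<eta> \<gamma> x) \<in> W1inf_0 \<Omega> \<and>
           Linf_norm \<Omega> (\<lambda>x. u x - affine_map \<eta> \<gamma> x) < ereal \<epsilon>"
proof -
  have \<Omega>: "open \<Omega>" "bounded \<Omega>" using assms(1) by (auto simp: bounded_lipschitz_domain_def)
  have \<Omega>m: "\<Omega> \<in> sets borel" using \<Omega>(1) by simp
  \<comment> \<open>\<open>infdist_near_K\<close> costs a factor 8, and 8 times \<epsilon>/16 is
    still strictly below \<epsilon>; the geometric lemmas ask for s \<le> 1/2.\<close>
  define s where "s = min (1/2) (\<epsilon> / 16)"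
  have s: "0 < s" "s \<le> 1/2" "8 * s < \<epsilon>" using assms(4) by (auto simp: s_def min_def)
  have \<eta>: "\<eta> \<in> hull_nbhd s" using rc_hull_subset_hull_nbhd[OF s(1)] assms(3) by blast
  \<comment> \<open>Half of \<epsilon>, since the resulting bound on \<open>w\<close> is not
    strict.\<close>
  have \<delta>: "\<epsilon> / 2 > 0" using assms(4) by simp
  obtain \<psi> :: "nat \<Rightarrow> real^2 \<Rightarrow> real" and w Z where
    adm: "\<And>n. admissible \<Omega> k \<eta> s (\<psi> n)" and
    w: "\<And>n x. norm (w x - pot_field k (\<psi> n) x) \<le> \<epsilon> / 2 * (1/2) ^ n" and
    wb: "\<And>x. norm (w x) \<le> \<epsilon> / 2" and
    Z: "Z \<in> null_sets lborel" and
    stab: "\<And>x. x \<notin> Z \<Longrightarrow> \<exists>N. (\<forall>n\<ge>N. pot_grad k (\<psi> n) x = pot_grad k (\<psi> N) x)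
        \<and> (x \<in> \<Omega> \<longrightarrow> \<eta> + pot_grad k (\<psi> N) x \<in> near_K s)"
    by (rule approximating_sequence[OF \<Omega> s(1,2) assms(2) \<delta> \<eta>]) (rule that)
  have sm: "smooth (\<psi> n)" for n using adm by (simp add: admissible_def)
  have smf: "smooth (pot_field k (\<psi> n))" for n by (rule smooth_pot_field[OF sm])
  \<comment> \<open>Set to 0 on \<open>Z\<close>, so that the sequence converges at every point and
    its limit \<open>G\<close> is Borel measurable.\<close>
  define F where "F n x = (if x \<in> Z then 0 else pot_grad k (\<psi> n) x)" for n x
  define G where "G x = lim (\<lambda>n. F n x)" for x
  have Flim: "(\<lambda>n. F n x) \<longlonglongrightarrow> pot_grad k (\<psi> N) x"
    if "x \<notin> Z" "\<forall>n\<ge>N. pot_grad k (\<psi> n) x = pot_grad k (\<psi> N) x" for x N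
  proof (rule tendsto_eventually[OF eventually_sequentiallyI[of N]])
    fix n assume "N \<le> n"
    with that(2) have "pot_grad k (\<psi> n) x = pot_grad k (\<psi> N) x" by blast
    then show "F n x = pot_grad k (\<psi> N) x" using that(1) by (simp add: F_def)
  qed
  have G_eq: "G x = pot_grad k (\<psi> N) x"
    if "x \<notin> Z" "\<forall>n\<ge>N. pot_grad k (\<psi> n) x = pot_grad k (\<psi> N) x" for x N
    unfolding G_def by (rule limI[OF Flim[OF that]])
  have FG: "(\<lambda>n. F n x) \<longlonglongrightarrow> G x" for x
  proof (cases "x \<in> Z")
    case False
    then obtain N where N: "\<forall>n\<ge>N. pot_grad k (\<psi> n) x = pot_grad k (\<psi> N) x" using stab by blast
    show ?thesis unfolding G_eq[OF False N] by (rule Flim[OF False N])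
  qed (simp add: G_def F_def)
  have conv: "(\<lambda>n. pot_grad k (\<psi> n) x) \<longlonglongrightarrow> G x" if "x \<notin> Z" for x
    using FG[of x] that by (simp add: F_def)
  have gb: "norm (pot_grad k (\<psi> n) x) \<le> 32" for n x
    by (rule admissible_bound[OF adm s(1,2) \<eta>])
  have Gb: "norm (G x) \<le> 32" for x
    by (rule LIMSEQ_le_const2[OF tendsto_norm[OF FG]]) (use gb in \<open>auto simp: F_def\<close>)
  have gm: "pot_grad k (\<psi> n) \<in> borel_measurable borel" for n
    by (intro borel_measurable_continuous_onI continuous_pot_grad sm)
  have Gm: "G \<in> borel_measurable borel"
  proof (rule borel_measurable_LIMSEQ_metric)
    show "F n \<in> borel_measurable borel" for n
      unfolding F_def using gm[of n] Z by (intro measurable_If_set) (auto simp: null_sets_def)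
  qed (rule FG)
  have \<eta>b: "norm \<eta> \<le> 16" by (rule hull_nbhd_bounded[OF \<eta> s(1,2)])
  have wc: "continuous_on UNIV w"
    by (rule continuous_geometric_limit[OF smooth_continuous[OF smf] w])
  have wm: "w \<in> borel_measurable borel" by (rule borel_measurable_continuous_onI[OF wc])
  have wgw: "has_weak_gradient \<Omega> w G"
    by (rule weak_gradient_limit[where v = "\<lambda>n. pot_field k (\<psi> n)" and M = 32 and Z = Z, OF smf w])
       (simp_all add: jacobian_pot_field sm gb Gm Gb Z conv)
  define u where "u x = affine_map \<eta> \<gamma> x + w x" for x
  have uw: "(\<lambda>x. u x - affine_map \<eta> \<gamma> x) = w" by (simp add: u_def fun_eq_iff)
  have wgu: "has_weak_gradient \<Omega> u (\<lambda>x. \<eta> + G x)"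
  \<comment> \<open>The bound 48 is 16 for \<open>\<eta>\<close> plus 32 for the gradients of the
    potential fields.\<close>
  proof (rule weak_gradient_limit[where v = "\<lambda>n x. affine_map \<eta> \<gamma> x + pot_field k (\<psi> n) x" and M = 48 and Z = Z])
    show "smooth (\<lambda>x. affine_map \<eta> \<gamma> x + pot_field k (\<psi> n) x)" for n
      by (intro smooth_add smooth_affine_map smf)
    show "norm (u x - (affine_map \<eta> \<gamma> x + pot_field k (\<psi> n) x)) \<le> \<epsilon> / 2 * (1/2) ^ n" for n x
      using w[of x n] by (simp add: u_def)
    have "norm (\<eta> + X) \<le> 48" if "norm X \<le> 32" for X
      using norm_triangle_ineq[of \<eta> X] \<eta>b that by linarith
    then show "norm (jacobian (\<lambda>x. affine_map \<eta> \<gamma> x + pot_field k (\<psi> n) x) (at x)) \<le> 48"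
      "norm (\<eta> + G x) \<le> 48" for n x
      using gb Gb by (simp_all add: jacobian_affine_map_add smf jacobian_pot_field sm)
    show "(\<lambda>x. \<eta> + G x) \<in> borel_measurable borel" using Gm by measurable
    show "(\<lambda>n. jacobian (\<lambda>x. affine_map \<eta> \<gamma> x + pot_field k (\<psi> n) x) (at x)) \<longlonglongrightarrow> \<eta> + G x" if "x \<notin> Z" for x
      using conv[OF that] by (simp add: jacobian_affine_map_add smf jacobian_pot_field sm tendsto_add)
  qed (rule Z)
  have uc: "continuous_on UNIV u"
    unfolding u_def by (intro continuous_intros smooth_continuous smooth_affine_map wc)
  obtain R where R: "\<And>x. x \<in> \<Omega> \<Longrightarrow> norm (u x) \<le> R"
  proof -
    have "compact (u ` closure \<Omega>)"
      using \<Omega>(2) by (intro compact_continuous_image continuous_on_subset[OF uc]) auto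
    then obtain R where "\<forall>y\<in>u ` closure \<Omega>. norm y \<le> R"
      using compact_imp_bounded bounded_iff by metis
    then show thesis using that closure_subset by blast
  qed
  have "u \<in> Linf \<Omega>" by (rule Linf_bounded[OF borel_measurable_continuous_onI[OF uc] R])
  moreover have "(\<lambda>x. \<eta> + G x) \<in> Linf \<Omega>"
  proof (rule Linf_bounded)
    show "(\<lambda>x. \<eta> + G x) \<in> borel_measurable borel" using Gm by measurable
    show "norm (\<eta> + G x) \<le> norm \<eta> + 32" for x
      using norm_triangle_ineq[of \<eta> "G x"] Gb[of x] by linarith
  qed
  ultimately have u: "u \<in> W1inf \<Omega>" using wgu by (auto simp: W1inf_def)
  have "w \<in> Linf \<Omega>" "G \<in> Linf \<Omega>"
    by (rule Linf_bounded[OF wm wb], rule Linf_bounded[OF Gm Gb])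
  then have "w \<in> W1inf \<Omega>" using wgw by (auto simp: W1inf_def)
  \<comment> \<open>The potential fields have compact support in \<Omega> and serve as the
    approximating test functions themselves, which settles the boundary condition.\<close>
  moreover have "w \<in> W11_0 \<Omega>"
    unfolding W11_0_def mem_Collect_eq
  proof (intro exI[of _ G] exI[of _ "\<lambda>n. pot_field k (\<psi> n)"] conjI allI wgw test_function_pot_field[OF adm])
    show "(\<lambda>n. \<integral>\<^sup>+x\<in>\<Omega>. ennreal (norm (w x - pot_field k (\<psi> n) x)) \<partial>lebesgue) \<longlonglongrightarrow> 0"
    proof (rule nn_integral_dominated_null[OF _ _ Z _ \<Omega>m \<Omega>(2), where c = "\<epsilon> / 2"])
      show "(\<lambda>x. norm (w x - pot_field k (\<psi> n) x)) \<in> borel_measurable borel" for n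
        using wm smooth_measurable[OF smf[of n]] by measurable
      show "0 \<le> norm (w x - pot_field k (\<psi> n) x) \<and> norm (w x - pot_field k (\<psi> n) x) \<le> \<epsilon> / 2" for n x
      proof -
        have "\<epsilon> / 2 * (1/2) ^ n \<le> \<epsilon> / 2 * 1" using \<delta> by (intro mult_left_mono power_le_one) auto
        then show ?thesis using w[of x n] by simp
      qed
      show "(\<lambda>n. norm (w x - pot_field k (\<psi> n) x)) \<longlonglongrightarrow> 0" for x
        by (rule Lim_null_comparison[OF _ geometric_tendsto_0[of "\<epsilon> / 2"]]) (use w in auto)
    qed
    show "(\<lambda>n. \<integral>\<^sup>+x\<in>\<Omega>. ennreal (norm (G x - jacobian (pot_field k (\<psi> n)) (at x))) \<partial>lebesgue) \<longlonglongrightarrow> 0"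
      unfolding jacobian_pot_field[OF sm]
    proof (rule nn_integral_dominated_null[OF _ _ Z _ \<Omega>m \<Omega>(2), where c = 64])
      show "(\<lambda>x. norm (G x - pot_grad k (\<psi> n) x)) \<in> borel_measurable borel" for n
        using Gm gm[of n] by measurable
      show "0 \<le> norm (G x - pot_grad k (\<psi> n) x) \<and> norm (G x - pot_grad k (\<psi> n) x) \<le> 64" for n x
        using norm_triangle_ineq4[of "G x" "pot_grad k (\<psi> n) x"] Gb[of x] gb[of n x] by simp
      show "(\<lambda>n. norm (G x - pot_grad k (\<psi> n) x)) \<longlonglongrightarrow> 0" if "x \<notin> Z" for x
        using tendsto_norm[OF tendsto_diff[OF tendsto_const conv[OF that], of "G x"]] by simp
    qed
  qed
  ultimately have w0: "w \<in> W1inf_0 \<Omega>" by (simp add: W1inf_0_def)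
  have pt: "infdist (\<eta> + G x) K_set < \<epsilon> \<and> L_form k (\<eta> + G x) = 0" if xZ: "x \<in> \<Omega>" "x \<notin> Z" for x
  proof -
    obtain N where N: "\<forall>n\<ge>N. pot_grad k (\<psi> n) x = pot_grad k (\<psi> N) x" "\<eta> + pot_grad k (\<psi> N) x \<in> near_K s"
      using stab xZ by blast
    have Gx: "G x = pot_grad k (\<psi> N) x" by (rule G_eq[OF xZ(2) N(1)])
    have "L_form k (\<eta> + G x) = L_form k \<eta> + L_form k (G x)"
      by (simp add: L_form_def sum_2 algebra_simps)
    moreover have "L_form k (G x) = 0" unfolding Gx by (rule L_form_pot_grad[OF sm])
    \<comment> \<open>The form involves only off-diagonal entries, and these vanish on the
      hull.\<close>
    moreover have "L_form k \<eta> = 0"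
      using rc_hull_K_set(1,2)[OF assms(3)] by (simp add: L_form_def L_mat_def sum_2)
    moreover have "infdist (\<eta> + G x) K_set \<le> 8 * s" unfolding Gx by (rule infdist_near_K[OF N(2)])
    ultimately show ?thesis using s(3) by linarith
  qed
  have "Linf_norm \<Omega> w \<le> ereal (\<epsilon> / 2)" by (rule Linf_norm_le[OF wm wb])
  also have "\<dots> < ereal \<epsilon>" using assms(4) by simp
  finally have "Linf_norm \<Omega> (\<lambda>x. u x - affine_map \<eta> \<gamma> x) < ereal \<epsilon>" unfolding uw .
  moreover have "AE x in lebesgue_on \<Omega>. infdist (\<eta> + G x) K_set < \<epsilon>"
    "AE x in lebesgue_on \<Omega>. L_form k (\<eta> + G x) = 0"
    using pt by (auto intro: AE_lebesgue_on[OF Z _ \<Omega>m])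
  moreover have "(\<lambda>x. u x - affine_map \<eta> \<gamma> x) \<in> W1inf_0 \<Omega>" unfolding uw by (rule w0)
  ultimately show ?thesis using u wgu by blast
qed

end
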